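(* Let $n\ge 1$, let $Z_n$ be the basic $n$-cycle, let $I$ be a monomial ideal of $kZ_n$, and let $A=kZ_n/I$. Let $p$ be a nonzero nontrivial path in $A$. Then the path $p$ is perfect if and only if both vertices $s(p)$ and $t(p)$ are $\theta$-cyclically black.
   Context: Let $k$ be a field. $Z_n$ is the quiver with vertex set $\{1,\dots,n\}$ and arrows $\alpha_1,\dots,\alpha_n$ with $s(\alpha_i)=i$, $t(\alpha_i)=i+1$, where $n+1$ is identified with $1$. For an integer $m$, $[m]$ is the unique integer with $1\le[m]\le n$ and $m\equiv[m]$ modulo $n$. Paths are written from right to left; $s(p)$, $t(p)$ are the starting and terminating vertices of a path $p$; a path is nontrivial if its length is at least one; $pq$ is the concatenation when $s(p)=t(q)$. A monomial ideal $I$ is a two-sided ideal generated by some paths of length at least two which is admissible, i.e. $J^d\subseteq I\subseteq J^2$ for some $d\ge2$, where $J$ is the ideal generated by all arrows. A path $p$ is a nonzero path in $A$ if $p\notin I$; if a path $p$ lies in $I$ one writes $p=0$ in $A$. For $1\le i\le n$ let $P_i=Ae_i$ be the indecomposable projective left $A$-module at vertex $i$ and $c_i=\dim_kP_i$. Define $\theta\colon\{1,\dots,n\}\to\{1,\dots,n\}$ by $\theta(i)=[i+c_i]$. An element of $\bigcap_{d\ge0}\mathrm{Im}\,\theta^d$ is called $\theta$-cyclic. The projective module $P_i$ is called minimal if its radical $\mathrm{rad}\,P_i$ is non-projective (equivalently, $c_i\le c_{[i+1]}$). The vertex $i$ is black if $P_i$ is minimal. The vertex $i$ is $\theta$-cyclically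 black if $i$ is $\theta$-cyclic and $\theta^d(i)$ is black for each $d\ge0$. A pair $(p,q)$ of nonzero paths in $A$ is perfect if: (P1) both are nontrivial, $s(p)=t(q)$ and $pq=0$ in $A$; (P2) if $pq'=0$ in $A$ for a nonzero path $q'$ with $t(q')=s(p)$, then $q'=qq''$ for some path $q''$; (P3) if $p'q=0$ in $A$ for a nonzero path $p'$ with $s(p')=t(q)$, then $p'=p''p$ for some path $p''$. A nonzero path $p$ is perfect if there is a sequence $p=p_1,p_2,\dots,p_m,p_{m+1}=p$ ($m\ge 1$) of nonzero paths such that $(p_i,p_{i+1})$ is a perfect pair for all $1\le i\le m$. *)

theory Defs
  imports
    "Graph_Theory.Digraph"
    "Graph_Theory.Arc_Walk"
    "HOL-Library.Poly_Mapping"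
    "HOL-Algebra.Module"
    "HOL-Algebra.QuotRing"
    "HOL-Algebra.Ideal_Product"
    "HOL-Algebra.Embedded_Algebras"
begin

section \<open>Left modules over a ring\<close>

text \<open>
  The library locale \<^locale>\<open>module\<close> requires a commutative ring of scalars, so left modules over an
  arbitrary ring are introduced here, on the same record type; \<^locale>\<open>submodule\<close> can be reused.
\<close>

locale left_module = R?: ring R + M?: abelian_group M
    for R :: "('r, 'x) ring_scheme" (structure)
    and M :: "('r, 'm, 'y) module_scheme" (structure) +
  assumes smult_closed:
      "\<lbrakk>a \<in> carrier R; x \<in> carrier M\<rbrakk> \<Longrightarrow> a \<odot>\<^bsub>M\<^esub> x \<in> carrier M"
    and smult_l_distr:
      "\<lbrakk>a \<in> carrier R; b \<in> carrier R; x \<in> carrier M\<rbrakk> \<Longrightarrow>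
        (a \<oplus>\<^bsub>R\<^esub> b) \<odot>\<^bsub>M\<^esub> x = a \<odot>\<^bsub>M\<^esub> x \<oplus>\<^bsub>M\<^esub> b \<odot>\<^bsub>M\<^esub> x"
    and smult_r_distr:
      "\<lbrakk>a \<in> carrier R; x \<in> carrier M; y \<in> carrier M\<rbrakk> \<Longrightarrow>
        a \<odot>\<^bsub>M\<^esub> (x \<oplus>\<^bsub>M\<^esub> y) = a \<odot>\<^bsub>M\<^esub> x \<oplus>\<^bsub>M\<^esub> a \<odot>\<^bsub>M\<^esub> y"
    and smult_assoc:
      "\<lbrakk>a \<in> carrier R; b \<in> carrier R; x \<in> carrier M\<rbrakk> \<Longrightarrow>
        (a \<otimes>\<^bsub>R\<^esub> b) \<odot>\<^bsub>M\<^esub> x = a \<odot>\<^bsub>M\<^esub> (b \<odot>\<^bsub>M\<^esub> x)"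
    and smult_one:
      "x \<in> carrier M \<Longrightarrow> \<one>\<^bsub>R\<^esub> \<odot>\<^bsub>M\<^esub> x = x"

definition module_hom ::
  "('r, 'x) ring_scheme \<Rightarrow> ('r, 'm, 'y) module_scheme \<Rightarrow> ('r, 'n, 'z) module_scheme \<Rightarrow> ('m \<Rightarrow> 'n) set"
  where "module_hom R M N =
    {f \<in> carrier M \<rightarrow> carrier N.
       (\<forall>x\<in>carrier M. \<forall>y\<in>carrier M. f (x \<oplus>\<^bsub>M\<^esub> y) = f x \<oplus>\<^bsub>N\<^esub> f y) \<and>
       (\<forall>a\<in>carrier R. \<forall>x\<in>carrier M. f (a \<odot>\<^bsub>M\<^esub> x) = a \<odot>\<^bsub>N\<^esub> f x)}"

text \<open>
  The free module on a set: finitely supported functions, required to vanish off the basis.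
  The ring multiplication fields of a module record carry no meaning for modules.
\<close>

definition free_module :: "('r, 'x) ring_scheme \<Rightarrow> 'b set \<Rightarrow> ('r, 'b \<Rightarrow> 'r) module"
  where "free_module R B =
    \<lparr>carrier = {f. (\<forall>b\<in>B. f b \<in> carrier R) \<and> (\<forall>b. b \<notin> B \<longrightarrow> f b = \<zero>\<^bsub>R\<^esub>) \<and>
                   finite {b. f b \<noteq> \<zero>\<^bsub>R\<^esub>}},
     monoid.mult = undefined, one = undefined,
     zero = (\<lambda>b. \<zero>\<^bsub>R\<^esub>), add = (\<lambda>f g b. f b \<oplus>\<^bsub>R\<^esub> g b),
     smult = (\<lambda>a f b. a \<otimes>\<^bsub>R\<^esub> f b)\<rparr>"

text \<open>
  A module is projective if it is a direct summand of a free module, the summand being given by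
  its inclusion and projection. Taking the basis inside the type of elements of the module is
  no restriction: if a module is a direct summand of some free module, it is one of the free module
  on its own carrier, since any surjection onto it splits.
\<close>

definition projective_module :: "('r, 'x) ring_scheme \<Rightarrow> ('r, 'm, 'y) module_scheme \<Rightarrow> bool"
  where "projective_module R M \<longleftrightarrow>
    left_module R M \<and>
    (\<exists>(B :: 'm set) incl proj.
       incl \<in> module_hom R M (free_module R B) \<and>
       proj \<in> module_hom R (free_module R B) M \<and>
       (\<forall>x\<in>carrier M. proj (incl x) = x))"

definition maximal_submodule ::
  "'m set \<Rightarrow> ('r, 'x) ring_scheme \<Rightarrow> ('r, 'm) module \<Rightarrow> bool"
  where "maximal_submodule H R M \<longleftrightarrow>
    submodule H R M \<and> H \<noteq> carrier M \<and>
    (\<forall>H'. submodule H' R M \<and> H \<subseteq> H' \<longrightarrow> H' = H \<or> H' = carrier M)"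

definition module_radical :: "('r, 'x) ring_scheme \<Rightarrow> ('r, 'm) module \<Rightarrow> ('r, 'm) module"
  where "module_radical R M =
    M\<lparr>carrier := carrier M \<inter> \<Inter>{H. maximal_submodule H R M}\<rparr>"

definition left_ideal_module :: "('r, 'x) ring_scheme \<Rightarrow> 'r set \<Rightarrow> ('r, 'r) module"
  where "left_ideal_module R L =
    \<lparr>carrier = L, monoid.mult = monoid.mult R, one = \<one>\<^bsub>R\<^esub>, zero = \<zero>\<^bsub>R\<^esub>, add = add R,
     smult = monoid.mult R\<rparr>"


section \<open>Paths and path algebras\<close>

text \<open>
  A quiver is a \<^typ>\<open>('v, 'a) pre_digraph\<close>, with source map \<^const>\<open>tail\<close> and target map \<^const>\<open>head\<close>.
  A path is a starting vertex together with the list of its arrows in the order in which they are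
  traversed; \<open>(v, [])\<close> is the trivial path at \<open>v\<close>. As paths are written from right to left, the
  arrow list of a concatenation \<open>pq\<close> is the arrow list of \<open>q\<close> followed by that of \<open>p\<close>.
\<close>

type_synonym ('v, 'a) path = "'v \<times> 'a list"

definition path_source :: "('v, 'a) path \<Rightarrow> 'v"
  where "path_source p = fst p"

definition path_target :: "('v, 'a) pre_digraph \<Rightarrow> ('v, 'a) path \<Rightarrow> 'v"
  where "path_target Q p = pre_digraph.awlast Q (fst p) (snd p)"

definition path_length :: "('v, 'a) path \<Rightarrow> nat"
  where "path_length p = length (snd p)"

definition paths :: "('v, 'a) pre_digraph \<Rightarrow> ('v, 'a) path set"
  where "paths Q = {p. pre_digraph.awalk Q (path_source p) (snd p) (path_target Q p)}"

definition path_concat :: "('v, 'a) path \<Rightarrow> ('v, 'a) path \<Rightarrow> ('v, 'a) path"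
  where "path_concat p q = (fst q, snd q @ snd p)"

definition trivial_path :: "'v \<Rightarrow> ('v, 'a) path"
  where "trivial_path v = (v, [])"

definition path_algebra_scalar ::
  "('v, 'a) pre_digraph \<Rightarrow> 'k::field \<Rightarrow> ('v, 'a) path \<Rightarrow>\<^sub>0 'k"
  where "path_algebra_scalar Q c = (\<Sum>v\<in>verts Q. Poly_Mapping.single (trivial_path v) c)"

text \<open>Intended for quivers with finitely many vertices, where the path algebra has a unit.\<close>

definition path_algebra :: "('v, 'a) pre_digraph \<Rightarrow> (('v, 'a) path \<Rightarrow>\<^sub>0 'k::field) ring"
  where "path_algebra Q =
    \<lparr>carrier = {f. Poly_Mapping.keys f \<subseteq> paths Q},
     monoid.mult = (\<lambda>f g. \<Sum>p\<in>Poly_Mapping.keys f. \<Sum>q\<in>Poly_Mapping.keys g.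
       if path_source p = path_target Q q
       then Poly_Mapping.single (path_concat p q)
              (Poly_Mapping.lookup f p * Poly_Mapping.lookup g q)
       else 0),
     one = path_algebra_scalar Q 1,
     zero = 0,
     add = (+)\<rparr>"

definition path_elem :: "('v, 'a) path \<Rightarrow> ('v, 'a) path \<Rightarrow>\<^sub>0 'k::field"
  where "path_elem p = Poly_Mapping.single p 1"

definition arrow_ideal :: "('v, 'a) pre_digraph \<Rightarrow> (('v, 'a) path \<Rightarrow>\<^sub>0 'k::field) set"
  where "arrow_ideal Q = genideal (path_algebra Q) (path_elem ` {p \<in> paths Q. path_length p = 1})"

definition admissible_ideal ::
  "('v, 'a) pre_digraph \<Rightarrow> (('v, 'a) path \<Rightarrow>\<^sub>0 'k::field) set \<Rightarrow> bool"
  where "admissible_ideal Q I \<longleftrightarrow>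
    ideal I (path_algebra Q) \<and>
    (\<exists>d::nat. d \<ge> 2 \<and>
       arrow_ideal Q [^]\<^bsub>ideals_set (path_algebra Q)\<^esub> d \<subseteq> I \<and>
       I \<subseteq> arrow_ideal Q [^]\<^bsub>ideals_set (path_algebra Q)\<^esub> (2::nat))"

definition monomial_ideal ::
  "('v, 'a) pre_digraph \<Rightarrow> (('v, 'a) path \<Rightarrow>\<^sub>0 'k::field) set \<Rightarrow> bool"
  where "monomial_ideal Q I \<longleftrightarrow>
    admissible_ideal Q I \<and>
    (\<exists>S \<subseteq> {p \<in> paths Q. path_length p \<ge> 2}. I = genideal (path_algebra Q) (path_elem ` S))"

definition nonzero_path ::
  "('v, 'a) pre_digraph \<Rightarrow> (('v, 'a) path \<Rightarrow>\<^sub>0 'k::field) set \<Rightarrow> ('v, 'a) path \<Rightarrow> bool"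
  where "nonzero_path Q I p \<longleftrightarrow> p \<in> paths Q \<and> path_elem p \<notin> I"


section \<open>Perfect pairs and perfect paths\<close>

definition perfect_pair ::
  "('v, 'a) pre_digraph \<Rightarrow> (('v, 'a) path \<Rightarrow>\<^sub>0 'k::field) set \<Rightarrow>
    ('v, 'a) path \<Rightarrow> ('v, 'a) path \<Rightarrow> bool"
  where "perfect_pair Q I p q \<longleftrightarrow>
    nonzero_path Q I p \<and> nonzero_path Q I q \<and>
    (path_length p \<ge> 1 \<and> path_length q \<ge> 1 \<and>
      path_source p = path_target Q q \<and> path_elem (path_concat p q) \<in> I) \<and>
    (\<forall>q'. nonzero_path Q I q' \<and> path_target Q q' = path_source p \<and>
          path_elem (path_concat p q') \<in> I \<longrightarrow>
       (\<exists>q''\<in>paths Q. path_source q = path_target Q q'' \<and> q' = path_concat q q'')) \<and>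
    (\<forall>p'. nonzero_path Q I p' \<and> path_source p' = path_target Q q \<and>
          path_elem (path_concat p' q) \<in> I \<longrightarrow>
       (\<exists>p''\<in>paths Q. path_source p'' = path_target Q p \<and> p' = path_concat p'' p))"

definition perfect_path ::
  "('v, 'a) pre_digraph \<Rightarrow> (('v, 'a) path \<Rightarrow>\<^sub>0 'k::field) set \<Rightarrow> ('v, 'a) path \<Rightarrow> bool"
  where "perfect_path Q I p \<longleftrightarrow>
    nonzero_path Q I p \<and>
    (\<exists>(m::nat) (ps :: nat \<Rightarrow> ('v, 'a) path). m \<ge> 1 \<and> ps 1 = p \<and> ps (m + 1) = p \<and>
       (\<forall>i\<in>{1..m + 1}. nonzero_path Q I (ps i)) \<and>
       (\<forall>i\<in>{1..m}. perfect_pair Q I (ps i) (ps (i + 1))))"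


section \<open>Indecomposable projectives, and the resolution map of a basic cycle\<close>

definition vertex_idempotent ::
  "('v, 'a) pre_digraph \<Rightarrow> (('v, 'a) path \<Rightarrow>\<^sub>0 'k::field) set \<Rightarrow> 'v \<Rightarrow> (('v, 'a) path \<Rightarrow>\<^sub>0 'k) set"
  where "vertex_idempotent Q I v = I +>\<^bsub>path_algebra Q\<^esub> path_elem (trivial_path v)"

definition vertex_projective ::
  "('v, 'a) pre_digraph \<Rightarrow> (('v, 'a) path \<Rightarrow>\<^sub>0 'k::field) set \<Rightarrow> 'v \<Rightarrow>
    ((('v, 'a) path \<Rightarrow>\<^sub>0 'k) set, (('v, 'a) path \<Rightarrow>\<^sub>0 'k) set) module"
  where "vertex_projective Q I v =
    (let A = path_algebra Q Quot I
     in left_ideal_module A ((\<lambda>a. a \<otimes>\<^bsub>A\<^esub> vertex_idempotent Q I v) ` carrier A))"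

text \<open>
  The copy of the ground field inside the quotient algebra; left multiplication by it is the
  vector space structure on left ideals, as needed for the library's dimension function.
\<close>

definition scalar_subfield ::
  "('v, 'a) pre_digraph \<Rightarrow> (('v, 'a) path \<Rightarrow>\<^sub>0 'k::field) set \<Rightarrow> (('v, 'a) path \<Rightarrow>\<^sub>0 'k) set set"
  where "scalar_subfield Q I = range (\<lambda>c. I +>\<^bsub>path_algebra Q\<^esub> path_algebra_scalar Q c)"

definition vertex_projective_dim ::
  "('v, 'a) pre_digraph \<Rightarrow> (('v, 'a) path \<Rightarrow>\<^sub>0 'k::field) set \<Rightarrow> 'v \<Rightarrow> nat"
  where "vertex_projective_dim Q I v =
    ring.dim (path_algebra Q Quot I) (scalar_subfield Q I) (carrier (vertex_projective Q I v))"

definition black_vertex ::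
  "('v, 'a) pre_digraph \<Rightarrow> (('v, 'a) path \<Rightarrow>\<^sub>0 'k::field) set \<Rightarrow> 'v \<Rightarrow> bool"
  where "black_vertex Q I v \<longleftrightarrow>
    (let A = path_algebra Q Quot I
     in \<not> projective_module A (module_radical A (vertex_projective Q I v)))"

definition residue_vertex :: "nat \<Rightarrow> int \<Rightarrow> nat"
  where "residue_vertex n m = (THE j::nat. 1 \<le> j \<and> j \<le> n \<and> m mod int n = int j mod int n)"

definition basic_cycle :: "nat \<Rightarrow> (nat, nat) pre_digraph"
  where "basic_cycle n =
    \<lparr>verts = {1..n}, arcs = {1..n}, tail = (\<lambda>i. i), head = (\<lambda>i. residue_vertex n (int i + 1))\<rparr>"

definition theta :: "nat \<Rightarrow> ((nat, nat) path \<Rightarrow>\<^sub>0 'k::field) set \<Rightarrow> nat \<Rightarrow> nat"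
  where "theta n I i =
    residue_vertex n (int i + int (vertex_projective_dim (basic_cycle n) I i))"

definition theta_cyclic :: "nat \<Rightarrow> ((nat, nat) path \<Rightarrow>\<^sub>0 'k::field) set \<Rightarrow> nat \<Rightarrow> bool"
  where "theta_cyclic n I i \<longleftrightarrow> i \<in> (\<Inter>d::nat. (theta n I ^^ d) ` {1..n})"

definition theta_cyclically_black :: "nat \<Rightarrow> ((nat, nat) path \<Rightarrow>\<^sub>0 'k::field) set \<Rightarrow> nat \<Rightarrow> bool"
  where "theta_cyclically_black n I i \<longleftrightarrow>
    theta_cyclic n I i \<and> (\<forall>d::nat. black_vertex (basic_cycle n) I ((theta n I ^^ d) i))"

end

theory Submission
  imports Defs
begin

text \<open>
  A path on the cycle is determined by its source \<open>i\<close> and its length \<open>l\<close>, and since a path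
  containing a zero path is zero, it is nonzero exactly when \<open>l < c i\<close>, where \<open>c i\<close> is the number
  of nonzero paths starting at \<open>i\<close>, that is the dimension of the projective module at \<open>i\<close>. The
  whole ideal is therefore encoded by the function \<open>c\<close>, and truncating a path shows
  \<open>c i \<le> c (i + k) + k\<close>.

  Blackness is read off from \<open>c\<close> as well. The radical of the projective module at \<open>i\<close> is generated
  by the arrow \<open>a\<close> leaving \<open>i\<close>. Right multiplication by \<open>a\<close> maps the projective module at
  \<open>i + 1\<close> onto it, and the radical is projective exactly when this map is injective, that is when
  \<open>c i = c (i + 1) + 1\<close>. Hence \<open>i\<close> is black if and only if \<open>c i \<le> c (i + 1)\<close>
  (\<open>black_vertex_iff\<close>, \<open>black_iff\<close>).

  Consequently a nonzero path \<open>q\<close> of length \<open>l \<ge> 1\<close> from \<open>i\<close> to \<open>j\<close> is the right member of a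
  perfect pair if and only if \<open>i\<close> is black, and the left member is then the path \<open>next_path q\<close> of
  length \<open>c i - l\<close> starting at \<open>j\<close>, the shortest path whose product with \<open>q\<close> is zero
  (\<open>perfect_pairD\<close>, \<open>perfect_pair_next_path\<close>). If \<open>q\<close> has source \<open>s\<close> and target \<open>t\<close>, then
  \<open>next_path q\<close> has source \<open>t\<close> and target \<open>\<theta> s\<close>; two steps apply \<open>\<theta>\<close> to both ends.

  A perfect path is thus one that returns to itself under iteration of \<open>next_path\<close>, all sources
  met on the way being black, so both of its ends return under \<open>\<theta>\<close> and stay black. Conversely, on
  the finite set of nonzero nontrivial paths whose ends stay black forever, \<open>next_path\<close> is a
  self-map, and it is injective because the left member of a perfect pair determines the right one.
  Every element of this set lies on a cycle of \<open>next_path\<close>, which is what perfection means.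
\<close>

section \<open>Splitting paths\<close>

text \<open>
  Paths are pairs, and splitting a quantifier over paths into its two components would hide it from
  the facts about paths.
\<close>

declare split_paired_All [simp del] split_paired_Ex [simp del]

definition path_prefix :: "nat \<Rightarrow> ('v, 'a) path \<Rightarrow> ('v, 'a) path"
  where "path_prefix k p = (fst p, take k (snd p))"

definition path_suffix :: "('v, 'a) pre_digraph \<Rightarrow> nat \<Rightarrow> ('v, 'a) path \<Rightarrow> ('v, 'a) path"
  where "path_suffix Q k p = (path_target Q (path_prefix k p), drop k (snd p))"

lemma path_target_trivial [simp]: "path_target Q (trivial_path v) = v"
  by (simp add: path_target_def trivial_path_def pre_digraph.awalk_verts.simps)

lemma path_source_trivial [simp]: "path_source (trivial_path v) = v"
  by (simp add: path_source_def trivial_path_def)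

lemma path_length_trivial [simp]: "path_length (trivial_path v) = 0"
  by (simp add: path_length_def trivial_path_def)

lemma path_length_concat [simp]: "path_length (path_concat p q) = path_length q + path_length p"
  by (simp add: path_length_def path_concat_def)

lemma path_source_prefix [simp]: "path_source (path_prefix k p) = path_source p"
  by (simp add: path_source_def path_prefix_def)

lemma path_source_suffix [simp]: "path_source (path_suffix Q k p) = path_target Q (path_prefix k p)"
  by (simp add: path_source_def path_suffix_def)

lemma path_concat_suffix_prefix [simp]: "path_concat (path_suffix Q k p) (path_prefix k p) = p"
  by (simp add: path_concat_def path_suffix_def path_prefix_def)

lemma path_length_prefix [simp]: "path_length (path_prefix k p) = min (path_length p) k"
  by (simp add: path_length_def path_prefix_def)

lemma path_length_suffix [simp]: "path_length (path_suffix Q k p) = path_length p - k"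
  by (simp add: path_length_def path_suffix_def)

lemma path_prefix_concat [simp]: "path_prefix (path_length q) (path_concat p q) = q"
  by (simp add: path_length_def path_prefix_def path_concat_def)

lemma path_suffix_concat [simp]:
  "path_source p = path_target Q q \<Longrightarrow> path_suffix Q (path_length q) (path_concat p q) = p"
  by (cases p) (simp add: path_suffix_def path_source_def, simp add: path_length_def path_concat_def)

lemma path_prefix_0 [simp]: "path_prefix 0 p = trivial_path (path_source p)"
  by (simp add: path_prefix_def trivial_path_def path_source_def)

lemma path_suffix_0 [simp]: "path_suffix Q 0 p = p"
  by (cases p) (simp add: path_suffix_def path_source_def)

lemma path_prefix_length [simp]: "path_prefix (path_length p) p = p"
  by (simp add: path_prefix_def path_length_def)

lemma path_suffix_length [simp]: "path_suffix Q (path_length p) p = trivial_path (path_target Q p)"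
  by (simp add: path_suffix_def trivial_path_def, simp add: path_length_def)

lemma path_concat_trivial_left [simp]: "path_concat (trivial_path v) p = p"
  by (simp add: path_concat_def trivial_path_def)

lemma path_concat_trivial_right [simp]:
  "path_source p = v \<Longrightarrow> path_concat p (trivial_path v) = p"
  by (cases p) (simp add: path_concat_def trivial_path_def path_source_def)

lemma path_length_0_iff: "path_length p = 0 \<longleftrightarrow> p = trivial_path (path_source p)"
  by (cases p) (simp add: path_length_def trivial_path_def path_source_def)

lemma (in wf_digraph) path_concat_in_paths:
  "path_source p = path_target G q \<Longrightarrow>
    path_concat p q \<in> paths G \<longleftrightarrow> p \<in> paths G \<and> q \<in> paths G"
  by (cases p; cases q) (auto simp: paths_def path_source_def path_target_def path_concat_def awlast_append)

lemma (in wf_digraph) trivial_path_in_paths [simp]: "trivial_path v \<in> paths G \<longleftrightarrow> v \<in> verts G"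
  by (auto simp: paths_def path_source_def path_target_def trivial_path_def awalk_def)

lemma (in wf_digraph) path_source_in_verts: "p \<in> paths G \<Longrightarrow> path_source p \<in> verts G"
  by (auto simp: paths_def awalk_def)

lemma (in wf_digraph) path_target_in_verts: "p \<in> paths G \<Longrightarrow> path_target G p \<in> verts G"
  by (auto simp: paths_def)

lemma (in fin_digraph) finite_paths_of_length_less:
  "finite {p \<in> paths G. path_length p < d}"
proof (rule finite_subset)
  show "{p \<in> paths G. path_length p < d} \<subseteq>
      verts G \<times> {xs. set xs \<subseteq> arcs G \<and> length xs \<le> d}"
    by (auto simp: paths_def path_source_def path_length_def awalk_def)
  show "finite (verts G \<times> {xs. set xs \<subseteq> arcs G \<and> length xs \<le> d})"
    by (simp add: finite_lists_length_le)
qed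

section \<open>Multiplication in a path algebra\<close>

lemma path_algebra_sel:
  "carrier (path_algebra Q) = {f. Poly_Mapping.keys f \<subseteq> paths Q}"
  "\<zero>\<^bsub>path_algebra Q\<^esub> = 0"
  "f \<oplus>\<^bsub>path_algebra Q\<^esub> g = f + g"
  "\<one>\<^bsub>path_algebra Q\<^esub> = path_algebra_scalar Q 1"
  by (simp_all add: path_algebra_def)

text \<open>
  A path \<open>r\<close> is a concatenation of two composable paths in exactly \<open>path_length r + 1\<close> ways, one for
  each length of the first factor. This turns the product of the algebra into a convolution along
  \<open>r\<close>, with no condition left on sources and targets.
\<close>

lemma lookup_path_algebra_mult:
  fixes f g :: "('v, 'a) path \<Rightarrow>\<^sub>0 'k::field"
  shows "Poly_Mapping.lookup (f \<otimes>\<^bsub>path_algebra Q\<^esub> g) r =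
    (\<Sum>k\<le>path_length r. Poly_Mapping.lookup f (path_suffix Q k r) * Poly_Mapping.lookup g (path_prefix k r))"
proof -
  let ?f = "Poly_Mapping.lookup f" and ?g = "Poly_Mapping.lookup g"
  let ?split = "\<lambda>k. (path_suffix Q k r, path_prefix k r)"
  let ?ok = "\<lambda>p q. path_source p = path_target Q q \<and> path_concat p q = r"
  let ?K = "Poly_Mapping.keys f \<times> Poly_Mapping.keys g"
  have ok_iff: "?ok p q \<longleftrightarrow> (p, q) \<in> ?split ` {..path_length r}" for p q
  proof
    assume "?ok p q"
    then have "(p, q) = ?split (path_length q)" "path_length q \<le> path_length r"
      by auto
    then show "(p, q) \<in> ?split ` {..path_length r}" by blast
  qed auto
  have "Poly_Mapping.lookup (f \<otimes>\<^bsub>path_algebra Q\<^esub> g) r =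
      (\<Sum>p\<in>Poly_Mapping.keys f. \<Sum>q\<in>Poly_Mapping.keys g. if ?ok p q then ?f p * ?g q else 0)"
    unfolding path_algebra_def monoid.simps
    by (auto simp: lookup_sum lookup_single when_def intro!: sum.cong)
  also have "\<dots> = (\<Sum>(p, q)\<in>?K. if (p, q) \<in> ?split ` {..path_length r} then ?f p * ?g q else 0)"
    unfolding sum.cartesian_product ok_iff ..
  also have "\<dots> = (\<Sum>(p, q)\<in>?split ` {..path_length r}. ?f p * ?g q)"
  proof -
    have "(\<Sum>(p, q)\<in>?K. if (p, q) \<in> ?split ` {..path_length r} then ?f p * ?g q else 0) =
        (\<Sum>(p, q)\<in>?K \<inter> ?split ` {..path_length r}. ?f p * ?g q)"
      by (subst sum.inter_restrict) (auto intro!: sum.cong)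
    also have "\<dots> = (\<Sum>(p, q)\<in>?split ` {..path_length r}. ?f p * ?g q)"
      by (rule sum.mono_neutral_left) (auto simp: in_keys_iff)
    finally show ?thesis .
  qed
  also have "\<dots> = (\<Sum>k\<le>path_length r. ?f (path_suffix Q k r) * ?g (path_prefix k r))"
  proof (subst sum.reindex)
    show "inj_on ?split {..path_length r}"
    proof (rule inj_onI)
      fix k l assume "k \<in> {..path_length r}" "l \<in> {..path_length r}" "?split k = ?split l"
      then have "min (path_length r) k = min (path_length r) l" "k \<le> path_length r" "l \<le> path_length r"
        by (metis Pair_inject path_length_prefix, auto)
      then show "k = l" by simp
    qed
  qed simp
  finally show ?thesis .
qed

lemma keys_path_algebra_mult:
  assumes "r \<in> Poly_Mapping.keys (f \<otimes>\<^bsub>path_algebra Q\<^esub> g)"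
  obtains p q where "p \<in> Poly_Mapping.keys f" "q \<in> Poly_Mapping.keys g"
    "path_source p = path_target Q q" "r = path_concat p q"
proof -
  have "(\<Sum>k\<le>path_length r. Poly_Mapping.lookup f (path_suffix Q k r) * Poly_Mapping.lookup g (path_prefix k r)) \<noteq> 0"
    using assms by (simp add: in_keys_iff lookup_path_algebra_mult)
  then obtain k where "Poly_Mapping.lookup f (path_suffix Q k r) * Poly_Mapping.lookup g (path_prefix k r) \<noteq> 0"
    using sum.not_neutral_contains_not_neutral by blast
  then show ?thesis
    by (intro that[of "path_suffix Q k r" "path_prefix k r"]) (auto simp: in_keys_iff)
qed

lemma single_mult_single:
  assumes "path_source p = path_target Q q"
  shows "Poly_Mapping.single p a \<otimes>\<^bsub>path_algebra Q\<^esub> Poly_Mapping.single q b =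
    Poly_Mapping.single (path_concat p q) (a * b :: 'k::field)"
  using assms by (simp add: path_algebra_def)

section \<open>Monomial ideals and nonzero paths\<close>

locale monomial_algebra = fin_digraph Q for Q :: "('v, 'a) pre_digraph" +
  fixes I :: "(('v, 'a) path \<Rightarrow>\<^sub>0 'k::field) set"
  assumes monomial: "monomial_ideal Q I"
begin

abbreviation "R \<equiv> path_algebra Q :: (('v, 'a) path \<Rightarrow>\<^sub>0 'k) ring"
abbreviation "A \<equiv> path_algebra Q Quot I"
abbreviation "nonzero \<equiv> nonzero_path Q I"

lemma ideal_I: "ideal I R"
  using monomial by (simp add: monomial_ideal_def admissible_ideal_def)

sublocale pa: ideal I "path_algebra Q"
  by (rule ideal_I)

sublocale A: ring "path_algebra Q Quot I"
  by (rule pa.quotient_is_ring)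

lemma single_in_carrier [simp]: "p \<in> paths Q \<Longrightarrow> Poly_Mapping.single p c \<in> carrier R"
  by (simp add: path_algebra_sel)

lemma path_elem_in_carrier [simp]: "p \<in> paths Q \<Longrightarrow> path_elem p \<in> carrier R"
  by (simp add: path_elem_def)

text \<open>
  Sets of paths that absorb concatenation on both sides span ideals. Applied to suitable sets, this
  bounds a monomial ideal from above without describing its elements as sums of products.
\<close>

lemma ideal_of_path_set:
  assumes "T \<subseteq> paths Q"
    and left: "\<And>p q. \<lbrakk>q \<in> T; p \<in> paths Q; path_source p = path_target Q q\<rbrakk> \<Longrightarrow> path_concat p q \<in> T"
    and right: "\<And>p q. \<lbrakk>p \<in> T; q \<in> paths Q; path_source p = path_target Q q\<rbrakk> \<Longrightarrow> path_concat p q \<in> T"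
  shows "ideal {f :: ('v, 'a) path \<Rightarrow>\<^sub>0 'k. Poly_Mapping.keys f \<subseteq> T} R"
proof (rule idealI)
  show "ring R" by (rule pa.ring_axioms)
  have inv: "\<ominus>\<^bsub>R\<^esub> f = - f" if "Poly_Mapping.keys f \<subseteq> T" for f :: "('v, 'a) path \<Rightarrow>\<^sub>0 'k"
    by (rule pa.minus_equality) (use that assms(1) in \<open>auto simp: path_algebra_sel\<close>)
  show "subgroup {f. Poly_Mapping.keys f \<subseteq> T} (add_monoid R)"
  proof (rule subgroup.intro)
    fix f g :: "('v, 'a) path \<Rightarrow>\<^sub>0 'k"
    assume "f \<in> {f. Poly_Mapping.keys f \<subseteq> T}" "g \<in> {f. Poly_Mapping.keys f \<subseteq> T}"
    then show "f \<otimes>\<^bsub>add_monoid R\<^esub> g \<in> {f. Poly_Mapping.keys f \<subseteq> T}"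
      using Poly_Mapping.keys_add[of f g] by (auto simp: path_algebra_sel)
  next
    fix f :: "('v, 'a) path \<Rightarrow>\<^sub>0 'k"
    assume "f \<in> {f. Poly_Mapping.keys f \<subseteq> T}"
    then show "inv\<^bsub>add_monoid R\<^esub> f \<in> {f. Poly_Mapping.keys f \<subseteq> T}"
      using inv[of f] by (simp add: a_inv_def)
  qed (use assms(1) in \<open>auto simp: path_algebra_sel\<close>)
next
  fix a x :: "('v, 'a) path \<Rightarrow>\<^sub>0 'k"
  assume "a \<in> {f. Poly_Mapping.keys f \<subseteq> T}" "x \<in> carrier R"
  then show "x \<otimes>\<^bsub>R\<^esub> a \<in> {f. Poly_Mapping.keys f \<subseteq> T}"
    using left by (auto elim!: keys_path_algebra_mult simp: path_algebra_sel subset_iff)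
next
  fix a x :: "('v, 'a) path \<Rightarrow>\<^sub>0 'k"
  assume "a \<in> {f. Poly_Mapping.keys f \<subseteq> T}" "x \<in> carrier R"
  then show "a \<otimes>\<^bsub>R\<^esub> x \<in> {f. Poly_Mapping.keys f \<subseteq> T}"
    using right by (auto elim!: keys_path_algebra_mult simp: path_algebra_sel subset_iff)
qed

text \<open>
  The generating paths lie in the ideal themselves, so to bound the ideal by another one it suffices
  to compare the long paths, and no set of generators has to be named.
\<close>

lemma monomial_generators_minimal:
  assumes "ideal K R" "\<And>p. \<lbrakk>p \<in> paths Q; path_length p \<ge> 2; path_elem p \<in> I\<rbrakk> \<Longrightarrow> path_elem p \<in> K"
  shows "I \<subseteq> K"
proof -
  obtain S where S: "S \<subseteq> {p \<in> paths Q. path_length p \<ge> 2}" "I = genideal R (path_elem ` S)"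
    using monomial unfolding monomial_ideal_def by blast
  have "path_elem ` S \<subseteq> I"
    unfolding S(2) using S(1) by (intro pa.genideal_self) auto
  then show ?thesis
    unfolding S(2) using S assms by (intro pa.genideal_minimal) auto
qed

lemma zero_path_in_paths: "path_elem p \<in> I \<Longrightarrow> p \<in> paths Q"
  using pa.Icarr[of "path_elem p"] by (simp add: path_algebra_sel path_elem_def)

lemma path_elem_concat:
  "path_source p = path_target Q q \<Longrightarrow>
    path_elem (path_concat p q) = path_elem p \<otimes>\<^bsub>R\<^esub> path_elem q"
  by (simp add: path_elem_def single_mult_single)

lemma zero_path_concat:
  assumes "path_source p = path_target Q q" "p \<in> paths Q" "q \<in> paths Q"
    and "path_elem p \<in> I \<or> path_elem q \<in> I"
  shows "path_elem (path_concat p q) \<in> I"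
  using assms by (auto simp: path_elem_concat intro: pa.I_l_closed pa.I_r_closed)

lemma nonzero_path_concatD:
  assumes "nonzero (path_concat p q)" "path_source p = path_target Q q"
  shows "nonzero p" "nonzero q"
  using assms zero_path_concat[OF assms(2)] path_concat_in_paths[OF assms(2)]
  by (auto simp: nonzero_path_def)

text \<open>
  The zero paths of length at least two absorb concatenation and contain the generators; hence the
  ideal they span contains the monomial ideal.
\<close>

lemma keys_of_monomial_ideal:
  assumes "f \<in> I" "p \<in> Poly_Mapping.keys f"
  shows "path_elem p \<in> I" "path_length p \<ge> 2"
proof -
  let ?T = "{p. path_elem p \<in> I \<and> path_length p \<ge> 2}"
  have "I \<subseteq> {f. Poly_Mapping.keys f \<subseteq> ?T}"
  proof (rule monomial_generators_minimal)
    show "ideal {f. Poly_Mapping.keys f \<subseteq> ?T} R"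
      by (rule ideal_of_path_set) (auto simp: zero_path_in_paths zero_path_concat)
  qed (simp add: path_elem_def)
  then show "path_elem p \<in> I" "path_length p \<ge> 2"
    using assms by auto
qed

lemma nonzero_if_short: "\<lbrakk>p \<in> paths Q; path_length p < 2\<rbrakk> \<Longrightarrow> nonzero p"
  using keys_of_monomial_ideal(2)[of "path_elem p" p] by (auto simp: nonzero_path_def path_elem_def)

lemma nonzero_trivial_path: "v \<in> verts Q \<Longrightarrow> nonzero (trivial_path v)"
  by (simp add: nonzero_if_short)

lemma single_in_I:
  assumes "path_elem p \<in> I"
  shows "Poly_Mapping.single p c \<in> I"
proof -
  have p: "p \<in> paths Q" using assms by (rule zero_path_in_paths)
  have "Poly_Mapping.single (trivial_path (path_target Q p)) c \<otimes>\<^bsub>R\<^esub> path_elem p \<in> I"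
    using assms p by (intro pa.I_l_closed) (auto simp: path_target_in_verts)
  then show ?thesis
    by (simp add: path_elem_def single_mult_single)
qed

lemma in_monomial_ideal_iff:
  "f \<in> I \<longleftrightarrow> (\<forall>p\<in>Poly_Mapping.keys f. path_elem p \<in> I)"
proof
  assume f: "\<forall>p\<in>Poly_Mapping.keys f. path_elem p \<in> I"
  have sum_in: "(\<Sum>p\<in>S. Poly_Mapping.single p (Poly_Mapping.lookup f p)) \<in> I"
    if "finite S" "S \<subseteq> Poly_Mapping.keys f" for S
    using that
  proof (induction S)
    case empty
    then show ?case using additive_subgroup.zero_closed[OF pa.is_additive_subgroup] by (simp add: path_algebra_sel)
  next
    case (insert p S)
    then show ?case
      using additive_subgroup.a_closed[OF pa.is_additive_subgroup single_in_I[of p "Poly_Mapping.lookup f p"]] f by (simp add: path_algebra_sel)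
  qed
  have "f = (\<Sum>p\<in>Poly_Mapping.keys f. Poly_Mapping.single p (Poly_Mapping.lookup f p))"
    by (rule poly_mapping_eqI) (auto simp: lookup_sum lookup_single when_def in_keys_iff)
  then show "f \<in> I" using sum_in[of "Poly_Mapping.keys f"] by simp
qed (simp add: keys_of_monomial_ideal)

text \<open>
  Peeling off the first arrow exhibits a path of length \<open>d\<close> as a product of \<open>d\<close> arrows.
\<close>

lemma path_elem_in_power_of_arrow_ideal:
  "\<lbrakk>p \<in> paths Q; path_length p = d\<rbrakk> \<Longrightarrow>
    (path_elem p :: ('v, 'a) path \<Rightarrow>\<^sub>0 'k) \<in> arrow_ideal Q [^]\<^bsub>ideals_set R\<^esub> d"
proof (induction d arbitrary: p)
  case 0
  then show ?case by (simp add: nat_pow_def ideals_set_def)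
next
  case (Suc d)
  let ?a = "path_prefix 1 p" and ?q = "path_suffix Q 1 p"
  have "?a \<in> paths Q" "?q \<in> paths Q"
    using Suc.prems(1) path_concat_in_paths[of ?q ?a] by simp_all
  then have "(path_elem ?q :: ('v, 'a) path \<Rightarrow>\<^sub>0 'k) \<in> arrow_ideal Q [^]\<^bsub>ideals_set R\<^esub> d"
    using Suc by simp
  moreover have "(path_elem ?a :: ('v, 'a) path \<Rightarrow>\<^sub>0 'k) \<in> arrow_ideal Q"
    unfolding arrow_ideal_def using \<open>?a \<in> paths Q\<close> Suc.prems
    by (intro subsetD[OF pa.genideal_self]) auto
  ultimately have "path_elem ?q \<otimes>\<^bsub>R\<^esub> path_elem ?a
      \<in> ideal_prod R (arrow_ideal Q [^]\<^bsub>ideals_set R\<^esub> d) (arrow_ideal Q)"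
    by (rule ideal_prod.prod)
  moreover have "path_elem ?q \<otimes>\<^bsub>R\<^esub> path_elem ?a = (path_elem p :: ('v, 'a) path \<Rightarrow>\<^sub>0 'k)"
    by (subst path_elem_concat[symmetric]) simp_all
  ultimately show ?case
    by (simp add: nat_pow_def ideals_set_def)
qed

lemma nonzero_paths_bounded: "\<exists>d. \<forall>p. nonzero p \<longrightarrow> path_length p < d"
proof -
  obtain d where d: "arrow_ideal Q [^]\<^bsub>ideals_set R\<^esub> (d::nat) \<subseteq> I"
    using monomial unfolding monomial_ideal_def admissible_ideal_def by blast
  have "path_length p < d" if "nonzero p" for p
  proof (rule ccontr)
    assume "\<not> path_length p < d"
    then have len: "path_length (path_prefix d p) = d" by simp
    have "nonzero (path_concat (path_suffix Q d p) (path_prefix d p))" using that by simp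
    then have "nonzero (path_prefix d p)" by (rule nonzero_path_concatD) simp
    then show False
      using path_elem_in_power_of_arrow_ideal[OF _ len] d by (auto simp: nonzero_path_def)
  qed
  then show ?thesis by blast
qed

lemma finite_nonzero_paths: "finite {p. nonzero p}"
proof -
  obtain d where "\<forall>p. nonzero p \<longrightarrow> path_length p < d" using nonzero_paths_bounded by blast
  then show ?thesis
    by (intro finite_subset[OF _ finite_paths_of_length_less[of d]]) (auto simp: nonzero_path_def)
qed

section \<open>The quotient algebra in coordinates\<close>

text \<open>
  Because the ideal is spanned by paths, the coefficient of a nonzero path is the same for all
  representatives of a coset. For zero paths the chosen representative matters and the value is
  meaningless. With \<open>combination\<close> as inverse, these coefficients identify the quotient algebra with
  the functions on the finite set of nonzero paths.
\<close>

definition coefficient :: "(('v, 'a) path \<Rightarrow>\<^sub>0 'k) set \<Rightarrow> ('v, 'a) path \<Rightarrow> 'k"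
  where "coefficient X p = Poly_Mapping.lookup (SOME f. f \<in> X) p"

definition combination :: "(('v, 'a) path \<Rightarrow> 'k) \<Rightarrow> (('v, 'a) path \<Rightarrow>\<^sub>0 'k) set"
  where "combination g = I +>\<^bsub>R\<^esub> (\<Sum>p\<in>{p. nonzero p}. Poly_Mapping.single p (g p))"

lemma coset_in_quotient [simp]: "f \<in> carrier R \<Longrightarrow> I +>\<^bsub>R\<^esub> f \<in> carrier A"
  using pa.a_rcosetsI[OF pa.a_subset] by (simp add: FactRing_def)

lemma quotient_cases:
  assumes "X \<in> carrier A"
  obtains f where "f \<in> carrier R" "X = I +>\<^bsub>R\<^esub> f"
  using assms by (auto simp: FactRing_def A_RCOSETS_def')

lemma coefficient_coset:
  assumes "f \<in> carrier R" "nonzero p"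
  shows "coefficient (I +>\<^bsub>R\<^esub> f) p = Poly_Mapping.lookup f p"
proof -
  have "f \<in> I +>\<^bsub>R\<^esub> f" using assms(1) by (rule pa.a_rcos_self)
  then have "(SOME g. g \<in> I +>\<^bsub>R\<^esub> f) \<in> I +>\<^bsub>R\<^esub> f" by (rule someI)
  then obtain h where h: "h \<in> I" "(SOME g. g \<in> I +>\<^bsub>R\<^esub> f) = h + f"
    by (auto simp: a_r_coset_def r_coset_def path_algebra_sel)
  have "Poly_Mapping.lookup h p = 0"
    using h(1) assms(2) in_monomial_ideal_iff[of h] by (auto simp: nonzero_path_def in_keys_iff)
  then show ?thesis by (simp add: coefficient_def h(2) lookup_add)
qed

lemma quotient_eqI:
  assumes "X \<in> carrier A" "Y \<in> carrier A" "\<And>p. nonzero p \<Longrightarrow> coefficient X p = coefficient Y p"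
  shows "X = Y"
proof -
  obtain f where f: "f \<in> carrier R" "X = I +>\<^bsub>R\<^esub> f" using assms(1) by (rule quotient_cases)
  obtain g where g: "g \<in> carrier R" "Y = I +>\<^bsub>R\<^esub> g" using assms(2) by (rule quotient_cases)
  have "f - g \<in> I"
  proof (rule iffD2[OF in_monomial_ideal_iff], rule ballI)
    fix p assume p: "p \<in> Poly_Mapping.keys (f - g)"
    then have "p \<in> paths Q"
      using Poly_Mapping.keys_diff[of f g] f(1) g(1) by (auto simp: path_algebra_sel)
    moreover have "Poly_Mapping.lookup f p \<noteq> Poly_Mapping.lookup g p"
      using p by (auto simp: in_keys_iff lookup_minus)
    ultimately show "path_elem p \<in> I"
      using assms(3)[of p] f g by (auto simp: coefficient_coset nonzero_path_def)
  qed
  then have "f \<in> I +>\<^bsub>R\<^esub> g"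
    by (auto simp: a_r_coset_def r_coset_def path_algebra_sel intro!: bexI[of _ "f - g"])
  then show ?thesis
    unfolding f(2) g(2) by (rule pa.a_repr_independence'[OF _ g(1), symmetric])
qed

lemma sum_of_singles_in_carrier:
  "(\<Sum>p\<in>{p. nonzero p}. Poly_Mapping.single p (g p)) \<in> carrier R"
proof -
  have "Poly_Mapping.keys (\<Sum>p\<in>{p. nonzero p}. Poly_Mapping.single p (g p)) \<subseteq>
      (\<Union>p\<in>{p. nonzero p}. Poly_Mapping.keys (Poly_Mapping.single p (g p)))"
    by (rule Poly_Mapping.keys_sum)
  also have "\<dots> \<subseteq> paths Q"
    by (auto simp: nonzero_path_def split: if_splits)
  finally show ?thesis by (simp add: path_algebra_sel)
qed

lemma combination_closed [simp]: "combination g \<in> carrier A"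
  unfolding combination_def by (rule coset_in_quotient[OF sum_of_singles_in_carrier])

lemma coefficient_combination [simp]:
  assumes "nonzero p"
  shows "coefficient (combination g) p = g p"
proof -
  have "coefficient (combination g) p =
      (\<Sum>q\<in>{p. nonzero p}. Poly_Mapping.lookup (Poly_Mapping.single q (g q)) p)"
    unfolding combination_def coefficient_coset[OF sum_of_singles_in_carrier assms] lookup_sum ..
  also have "\<dots> = (\<Sum>q\<in>{p. nonzero p}. if q = p then g q else 0)"
    by (rule sum.cong) (auto simp: lookup_single when_def)
  also have "\<dots> = g p"
    using assms sum.delta[OF finite_nonzero_paths, of p g] by simp
  finally show ?thesis .
qed

lemma coefficient_add [simp]:
  assumes "X \<in> carrier A" "Y \<in> carrier A" "nonzero p"
  shows "coefficient (X \<oplus>\<^bsub>A\<^esub> Y) p = coefficient X p + coefficient Y p"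
proof -
  obtain f where f: "f \<in> carrier R" "X = I +>\<^bsub>R\<^esub> f" using assms(1) by (rule quotient_cases)
  obtain g where g: "g \<in> carrier R" "Y = I +>\<^bsub>R\<^esub> g" using assms(2) by (rule quotient_cases)
  have "X \<oplus>\<^bsub>A\<^esub> Y = I +>\<^bsub>R\<^esub> (f \<oplus>\<^bsub>R\<^esub> g)"
    using f g by (simp add: FactRing_def pa.a_rcos_sum)
  then show ?thesis
    using f g assms(3) pa.add.m_closed[OF f(1) g(1)]
    by (simp add: coefficient_coset path_algebra_sel lookup_add)
qed

lemma coefficient_zero [simp]: "nonzero p \<Longrightarrow> coefficient \<zero>\<^bsub>A\<^esub> p = 0"
  using coefficient_add[of "\<zero>\<^bsub>A\<^esub>" "\<zero>\<^bsub>A\<^esub>" p]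
  by (simp only: A.l_zero A.zero_closed add_cancel_right_right)

lemma coefficient_a_inv [simp]:
  "X \<in> carrier A \<Longrightarrow> nonzero p \<Longrightarrow> coefficient (\<ominus>\<^bsub>A\<^esub> X) p = - coefficient X p"
  using coefficient_add[of X "\<ominus>\<^bsub>A\<^esub> X" p] by (simp add: A.r_neg eq_neg_iff_add_eq_0 add.commute)

lemma nonzero_prefix: "nonzero p \<Longrightarrow> nonzero (path_prefix k p)"
  using nonzero_path_concatD(2)[of "path_suffix Q k p" "path_prefix k p"] by simp

lemma nonzero_suffix: "nonzero p \<Longrightarrow> nonzero (path_suffix Q k p)"
  using nonzero_path_concatD(1)[of "path_suffix Q k p" "path_prefix k p"] by simp

text \<open>
  Prefixes and suffixes of a nonzero path are nonzero, so the convolution formula of the path algebra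
  only involves coefficients that are well defined in the quotient.
\<close>

lemma coefficient_mult:
  assumes "X \<in> carrier A" "Y \<in> carrier A" "nonzero p"
  shows "coefficient (X \<otimes>\<^bsub>A\<^esub> Y) p =
    (\<Sum>k\<le>path_length p. coefficient X (path_suffix Q k p) * coefficient Y (path_prefix k p))"
proof -
  obtain f where f: "f \<in> carrier R" "X = I +>\<^bsub>R\<^esub> f" using assms(1) by (rule quotient_cases)
  obtain g where g: "g \<in> carrier R" "Y = I +>\<^bsub>R\<^esub> g" using assms(2) by (rule quotient_cases)
  have "X \<otimes>\<^bsub>A\<^esub> Y = I +>\<^bsub>R\<^esub> (f \<otimes>\<^bsub>R\<^esub> g)"
    using f g by (simp add: FactRing_def pa.rcoset_mult_add)
  then show ?thesis
    using f g assms(3) pa.m_closed[OF f(1) g(1)]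
    by (simp add: coefficient_coset lookup_path_algebra_mult nonzero_prefix nonzero_suffix)
qed

end

section \<open>Left ideals as modules\<close>

definition (in ring) left_ideal :: "'a set \<Rightarrow> bool"
  where "left_ideal L \<longleftrightarrow>
    subgroup L (add_monoid R) \<and> (\<forall>a\<in>carrier R. \<forall>x\<in>L. a \<otimes> x \<in> L)"

lemma left_ideal_module_sel:
  "carrier (left_ideal_module S L) = L"
  "\<zero>\<^bsub>left_ideal_module S L\<^esub> = \<zero>\<^bsub>S\<^esub>"
  "x \<oplus>\<^bsub>left_ideal_module S L\<^esub> y = x \<oplus>\<^bsub>S\<^esub> y"
  "a \<odot>\<^bsub>left_ideal_module S L\<^esub> x = a \<otimes>\<^bsub>S\<^esub> x"
  by (simp_all add: left_ideal_module_def)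

text \<open>
  The two additive monoids agree up to the record extension field. They are terms of different types
  in general, which is why this transfer is stated for the predicates and not as an equation.
\<close>

lemma subgroup_add_monoid_left_ideal_module:
  "subgroup H (add_monoid (left_ideal_module S L)) \<longleftrightarrow>
    subgroup H ((add_monoid S)\<lparr>carrier := L\<rparr>)"
  by (simp add: subgroup_def m_inv_def left_ideal_module_def)

lemma comm_group_add_monoid_left_ideal_module:
  "comm_group (add_monoid (left_ideal_module S L)) \<longleftrightarrow>
    comm_group ((add_monoid S)\<lparr>carrier := L\<rparr>)"
  by (simp add: comm_group_def comm_monoid_def comm_monoid_axioms_def group_def group_axioms_def
      Group.monoid_def Units_def left_ideal_module_def)

context ring
begin

lemma left_idealI:
  assumes "L \<subseteq> carrier R" "\<zero> \<in> L"
    and "\<And>x y. \<lbrakk>x \<in> L; y \<in> L\<rbrakk> \<Longrightarrow> x \<oplus> y \<in> L"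
    and mult: "\<And>a x. \<lbrakk>a \<in> carrier R; x \<in> L\<rbrakk> \<Longrightarrow> a \<otimes> x \<in> L"
  shows "left_ideal L"
proof -
  have "\<ominus> x \<in> L" if "x \<in> L" for x
    using mult[of "\<ominus> \<one>" x] that assms(1) by (auto simp: l_minus)
  then have "subgroup L (add_monoid R)"
    using assms by (intro add.subgroupI) (auto simp: a_inv_def)
  then show ?thesis using mult by (simp add: left_ideal_def)
qed

lemma left_idealD:
  assumes "left_ideal L"
  shows "L \<subseteq> carrier R" "\<zero> \<in> L"
    and "\<lbrakk>x \<in> L; y \<in> L\<rbrakk> \<Longrightarrow> x \<oplus> y \<in> L"
    and "\<lbrakk>a \<in> carrier R; x \<in> L\<rbrakk> \<Longrightarrow> a \<otimes> x \<in> L"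
  using assms subgroup.subset[of L "add_monoid R"] subgroup.one_closed[of L "add_monoid R"]
    subgroup.m_closed[of L "add_monoid R" x y] by (auto simp: left_ideal_def)

lemma left_module_left_ideal:
  assumes "left_ideal L"
  shows "left_module R (left_ideal_module R L)"
proof -
  have "group ((add_monoid R)\<lparr>carrier := L\<rparr>)"
    using assms by (intro subgroup.subgroup_is_group add.is_group) (simp add: left_ideal_def)
  then have "comm_group ((add_monoid R)\<lparr>carrier := L\<rparr>)"
    using left_idealD(1)[OF assms] by (intro group.group_comm_groupI) (auto intro: add.m_comm)
  then have "comm_group (add_monoid (left_ideal_module R L))"
    unfolding comm_group_add_monoid_left_ideal_module .
  then have "abelian_group (left_ideal_module R L)"
    by (rule comm_group_abelian_groupI)
  moreover have "left_module_axioms R (left_ideal_module R L)"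
    using left_idealD[OF assms]
    by unfold_locales (auto simp: left_ideal_module_sel l_distr r_distr m_assoc subset_iff)
  ultimately show ?thesis
    using ring_axioms by (simp add: left_module_def)
qed

lemma submodule_left_ideal_module_iff:
  assumes "left_ideal L"
  shows "submodule H R (left_ideal_module R L) \<longleftrightarrow> left_ideal H \<and> H \<subseteq> L"
proof -
  have L: "subgroup L (add_monoid R)" using assms by (simp add: left_ideal_def)
  have eq: "subgroup H ((add_monoid R)\<lparr>carrier := L\<rparr>) \<longleftrightarrow> subgroup H (add_monoid R) \<and> H \<subseteq> L"
  proof
    assume H: "subgroup H ((add_monoid R)\<lparr>carrier := L\<rparr>)"
    show "subgroup H (add_monoid R) \<and> H \<subseteq> L"
      using add.incl_subgroup[OF L H] subgroup.subset[OF H] by simp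
  next
    assume "subgroup H (add_monoid R) \<and> H \<subseteq> L"
    then show "subgroup H ((add_monoid R)\<lparr>carrier := L\<rparr>)"
      using add.subgroup_incl L by blast
  qed
  show ?thesis
    unfolding submodule_def submodule_axioms_def subgroup_add_monoid_left_ideal_module
    unfolding left_ideal_module_sel left_ideal_def eq by auto
qed

end

section \<open>Dimensions of the vertex projectives\<close>

context monomial_algebra
begin

definition path_class :: "('v, 'a) path \<Rightarrow> (('v, 'a) path \<Rightarrow>\<^sub>0 'k) set"
  where "path_class p = I +>\<^bsub>R\<^esub> path_elem p"

definition scalar :: "'k \<Rightarrow> (('v, 'a) path \<Rightarrow>\<^sub>0 'k) set"
  where "scalar c = I +>\<^bsub>R\<^esub> path_algebra_scalar Q c"

lemma nonzero_path_in_paths: "nonzero p \<Longrightarrow> p \<in> paths Q"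
  by (simp add: nonzero_path_def)

lemma path_class_closed [simp]: "p \<in> paths Q \<Longrightarrow> path_class p \<in> carrier A"
  by (simp add: path_class_def)

lemma coefficient_path_class [simp]:
  "\<lbrakk>p \<in> paths Q; nonzero r\<rbrakk> \<Longrightarrow> coefficient (path_class p) r = (if r = p then 1 else 0)"
  by (simp add: path_class_def coefficient_coset, simp add: path_elem_def lookup_single when_def)

text \<open>
  Only one splitting of \<open>p\<close> can end in the prefix \<open>q\<close>, the one at the length of \<open>q\<close>. If \<open>q\<close> is longer
  than \<open>p\<close>, the prefix is all of \<open>p\<close> and differs from \<open>q\<close>, so the formula needs no comparison of
  lengths.
\<close>

lemma coefficient_mult_path_class:
  assumes "X \<in> carrier A" "q \<in> paths Q" "nonzero p"
  shows "coefficient (X \<otimes>\<^bsub>A\<^esub> path_class q) p =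
    (if path_prefix (path_length q) p = q then coefficient X (path_suffix Q (path_length q) p) else 0)"
proof -
  have eq: "path_prefix k p = q \<longleftrightarrow> k = path_length q \<and> path_prefix (path_length q) p = q"
    if "k \<le> path_length p" for k
    using that by (metis min.absorb2 path_length_prefix)
  have len: "path_length q \<le> path_length p" if "path_prefix (path_length q) p = q"
    using that by (metis min.cobounded1 path_length_prefix)
  have "coefficient (X \<otimes>\<^bsub>A\<^esub> path_class q) p =
      (\<Sum>k\<le>path_length p. if k = path_length q then
        (if path_prefix (path_length q) p = q then coefficient X (path_suffix Q k p) else 0) else 0)"
    unfolding coefficient_mult[OF assms(1) path_class_closed[OF assms(2)] assms(3)]
  proof (rule sum.cong[OF refl])
    fix k assume "k \<in> {..path_length p}"
    then show "coefficient X (path_suffix Q k p) * coefficient (path_class q) (path_prefix k p) =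
        (if k = path_length q then
          (if path_prefix (path_length q) p = q then coefficient X (path_suffix Q k p) else 0) else 0)"
      using eq[of k] coefficient_path_class[OF assms(2) nonzero_prefix[OF assms(3)]] by simp
  qed
  then show ?thesis using len by (cases "path_prefix (path_length q) p = q") simp_all
qed

lemma coefficient_path_class_mult:
  assumes "X \<in> carrier A" "q \<in> paths Q" "nonzero p"
  shows "coefficient (path_class q \<otimes>\<^bsub>A\<^esub> X) p =
    (if path_suffix Q (path_length p - path_length q) p = q
     then coefficient X (path_prefix (path_length p - path_length q) p) else 0)"
proof -
  let ?l = "path_length p - path_length q"
  have eq: "path_suffix Q k p = q \<longleftrightarrow> k = ?l \<and> path_suffix Q ?l p = q"
    if "k \<le> path_length p" for k
    using that path_length_suffix[of Q k p] by auto
  have "coefficient (path_class q \<otimes>\<^bsub>A\<^esub> X) p =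
      (\<Sum>k\<le>path_length p. if k = ?l then
        (if path_suffix Q ?l p = q then coefficient X (path_prefix k p) else 0) else 0)"
    unfolding coefficient_mult[OF path_class_closed[OF assms(2)] assms(1) assms(3)]
  proof (rule sum.cong[OF refl])
    fix k assume "k \<in> {..path_length p}"
    then show "coefficient (path_class q) (path_suffix Q k p) * coefficient X (path_prefix k p) =
        (if k = ?l then (if path_suffix Q ?l p = q then coefficient X (path_prefix k p) else 0) else 0)"
      using eq[of k] coefficient_path_class[OF assms(2) nonzero_suffix[OF assms(3)]] by simp
  qed
  then show ?thesis by simp
qed

lemma lookup_path_algebra_scalar:
  assumes "p \<in> paths Q"
  shows "Poly_Mapping.lookup (path_algebra_scalar Q c) p = (if path_length p = 0 then c else 0)"
proof -
  have "Poly_Mapping.lookup (path_algebra_scalar Q c) p =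
      (\<Sum>v\<in>verts Q. if v = path_source p then (if path_length p = 0 then c else 0) else 0)"
    unfolding path_algebra_scalar_def lookup_sum
  proof (rule sum.cong[OF refl])
    fix v
    have "trivial_path v = p \<longleftrightarrow> path_length p = 0 \<and> v = path_source p"
      by (metis path_length_0_iff path_length_trivial path_source_trivial)
    then show "Poly_Mapping.lookup (Poly_Mapping.single (trivial_path v) c) p =
        (if v = path_source p then (if path_length p = 0 then c else 0) else 0)"
      by (simp add: lookup_single when_def)
  qed
  then show ?thesis using path_source_in_verts[OF assms] by (simp add: sum.delta)
qed

lemma path_algebra_scalar_closed: "path_algebra_scalar Q c \<in> carrier R"
proof -
  have "Poly_Mapping.keys (path_algebra_scalar Q c) \<subseteq>
      (\<Union>v\<in>verts Q. Poly_Mapping.keys (Poly_Mapping.single (trivial_path v) c))"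
    unfolding path_algebra_scalar_def by (rule Poly_Mapping.keys_sum)
  also have "\<dots> \<subseteq> paths Q" by (auto split: if_splits)
  finally show ?thesis by (simp add: path_algebra_sel)
qed

lemma scalar_closed [simp]: "scalar c \<in> carrier A"
  unfolding scalar_def by (rule coset_in_quotient[OF path_algebra_scalar_closed])

lemma coefficient_scalar [simp]:
  "nonzero p \<Longrightarrow> coefficient (scalar c) p = (if path_length p = 0 then c else 0)"
  by (simp add: scalar_def coefficient_coset[OF path_algebra_scalar_closed]
      lookup_path_algebra_scalar nonzero_path_in_paths)

lemma coefficient_scalar_mult [simp]:
  assumes "X \<in> carrier A" "nonzero p"
  shows "coefficient (scalar c \<otimes>\<^bsub>A\<^esub> X) p = c * coefficient X p"
proof -
  have "coefficient (scalar c \<otimes>\<^bsub>A\<^esub> X) p =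
      (\<Sum>k\<le>path_length p. if k = path_length p then c * coefficient X (path_prefix k p) else 0)"
    unfolding coefficient_mult[OF scalar_closed assms]
    by (rule sum.cong[OF refl]) (auto simp: coefficient_scalar[OF nonzero_suffix[OF assms(2)]])
  then show ?thesis by (simp add: sum.delta)
qed

lemma scalar_subfield_eq: "scalar_subfield Q I = range scalar"
  by (simp add: scalar_subfield_def scalar_def)

lemma scalar_1: "scalar 1 = \<one>\<^bsub>A\<^esub>"
  by (simp add: scalar_def FactRing_def path_algebra_sel)

lemma scalar_mult: "scalar c \<otimes>\<^bsub>A\<^esub> scalar d = scalar (c * d)"
  by (rule quotient_eqI) auto

lemma scalar_0_iff: "verts Q \<noteq> {} \<Longrightarrow> scalar c = \<zero>\<^bsub>A\<^esub> \<longleftrightarrow> c = 0"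
proof
  assume "verts Q \<noteq> {}" "scalar c = \<zero>\<^bsub>A\<^esub>"
  then obtain v where "nonzero (trivial_path v)" "scalar c = \<zero>\<^bsub>A\<^esub>"
    using nonzero_trivial_path by blast
  then show "c = 0" by (metis coefficient_scalar coefficient_zero path_length_trivial)
next
  assume "c = 0"
  then show "scalar c = \<zero>\<^bsub>A\<^esub>" by (intro quotient_eqI) simp_all
qed

text \<open>
  A vertex is needed for the quotient to be nontrivial; its trivial path is nonzero and detects
  scalars.
\<close>

lemma subfield_scalars:
  assumes "verts Q \<noteq> {}"
  shows "subfield (scalar_subfield Q I) A"
  unfolding scalar_subfield_eq
proof (rule A.subfieldI)
  have add: "scalar c \<oplus>\<^bsub>A\<^esub> scalar d = scalar (c + d)" for c d
    by (rule quotient_eqI) auto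
  have minus: "\<ominus>\<^bsub>A\<^esub> scalar c = scalar (- c)" for c
    by (rule quotient_eqI) auto
  have "subring (range scalar) A"
    by (rule A.subringI) (auto simp: add minus scalar_mult simp flip: scalar_1)
  then show "subcring (range scalar) A"
    by (rule A.subcringI) (auto simp: scalar_mult mult.commute)
  have "scalar c \<otimes>\<^bsub>A\<^esub> scalar d = \<one>\<^bsub>A\<^esub> \<longleftrightarrow> c * d = 1" for c d
  proof
    assume "scalar c \<otimes>\<^bsub>A\<^esub> scalar d = \<one>\<^bsub>A\<^esub>"
    then have "scalar (c * d) = scalar 1" by (simp add: scalar_mult scalar_1)
    moreover obtain v where "nonzero (trivial_path v)" using assms nonzero_trivial_path by blast
    ultimately show "c * d = 1" by (metis coefficient_scalar path_length_trivial)
  qed (simp add: scalar_mult scalar_1)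
  moreover have "(\<exists>d. d * c = 1 \<and> c * d = 1) \<longleftrightarrow> c \<noteq> 0" for c :: 'k
    by (metis left_inverse right_inverse mult_zero_left zero_neq_one)
  ultimately have "Units (A\<lparr>carrier := range scalar\<rparr>) = {X. \<exists>c. X = scalar c \<and> c \<noteq> 0}"
    unfolding Units_def by auto
  then show "Units (A\<lparr>carrier := range scalar\<rparr>) = range scalar - {\<zero>\<^bsub>A\<^esub>}"
    using scalar_0_iff[OF assms] by auto
qed

text \<open>
  The classes of finitely many nonzero paths span the coordinate subspace of these paths. As the list
  may be shortened freely, linear independence follows at once from the same description.
\<close>

lemma span_path_classes:
  assumes "distinct ps" "\<forall>p\<in>set ps. nonzero p"
  shows "A.Span (scalar_subfield Q I) (map path_class ps) =
    {X \<in> carrier A. \<forall>p. nonzero p \<and> p \<notin> set ps \<longrightarrow> coefficient X p = 0}"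
  using assms
proof (induction ps)
  case Nil
  have "X = \<zero>\<^bsub>A\<^esub> \<longleftrightarrow> X \<in> carrier A \<and> (\<forall>p. nonzero p \<longrightarrow> coefficient X p = 0)" for X
    using quotient_eqI[of X "\<zero>\<^bsub>A\<^esub>"] by auto
  then show ?case by auto
next
  case (Cons p ps)
  have p: "nonzero p" "p \<in> paths Q" "p \<notin> set ps" using Cons.prems by (auto simp: nonzero_path_def)
  let ?S = "A.Span (scalar_subfield Q I) (map path_class ps)"
  have IH: "?S = {X \<in> carrier A. \<forall>p. nonzero p \<and> p \<notin> set ps \<longrightarrow> coefficient X p = 0}"
    using Cons by simp
  have "X \<in> A.Span (scalar_subfield Q I) (map path_class (p # ps)) \<longleftrightarrow>
      (\<exists>c. \<exists>Y\<in>?S. X = scalar c \<otimes>\<^bsub>A\<^esub> path_class p \<oplus>\<^bsub>A\<^esub> Y)" for X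
    by (simp add: A.line_extension_mem_iff scalar_subfield_eq)
  also have "\<dots> X \<longleftrightarrow> X \<in> carrier A \<and> (\<forall>q. nonzero q \<and> q \<notin> set (p # ps) \<longrightarrow> coefficient X q = 0)" for X
  proof
    assume "\<exists>c. \<exists>Y\<in>?S. X = scalar c \<otimes>\<^bsub>A\<^esub> path_class p \<oplus>\<^bsub>A\<^esub> Y"
    then show "X \<in> carrier A \<and> (\<forall>q. nonzero q \<and> q \<notin> set (p # ps) \<longrightarrow> coefficient X q = 0)"
      unfolding IH using p by auto
  next
    assume X: "X \<in> carrier A \<and> (\<forall>q. nonzero q \<and> q \<notin> set (p # ps) \<longrightarrow> coefficient X q = 0)"
    let ?Y = "combination (\<lambda>q. if q = p then 0 else coefficient X q)"
    have "?Y \<in> ?S" unfolding IH using X by auto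
    moreover have "X = scalar (coefficient X p) \<otimes>\<^bsub>A\<^esub> path_class p \<oplus>\<^bsub>A\<^esub> ?Y"
      using X p by (intro quotient_eqI) auto
    ultimately show "\<exists>c. \<exists>Y\<in>?S. X = scalar c \<otimes>\<^bsub>A\<^esub> path_class p \<oplus>\<^bsub>A\<^esub> Y" by blast
  qed
  finally show ?case by blast
qed

lemma independent_path_classes:
  assumes "distinct ps" "\<forall>p\<in>set ps. nonzero p"
  shows "A.independent (scalar_subfield Q I) (map path_class ps)"
  using assms
proof (induction ps)
  case Nil
  then show ?case by simp
next
  case (Cons p ps)
  have p: "nonzero p" "p \<in> paths Q" "p \<notin> set ps" using Cons.prems by (auto simp: nonzero_path_def)
  have "path_class p \<notin> A.Span (scalar_subfield Q I) (map path_class ps)"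
  proof
    assume "path_class p \<in> A.Span (scalar_subfield Q I) (map path_class ps)"
    moreover have "distinct ps" "\<forall>p\<in>set ps. nonzero p" using Cons.prems by auto
    ultimately have "coefficient (path_class p) p = 0"
      using p by (simp only: span_path_classes) blast
    then show False using p by simp
  qed
  then show ?case using Cons p by (auto intro!: A.li_Cons)
qed

text \<open>
  The left ideal generated by the trivial path at \<open>v\<close>, described by coordinates: multiplying by this
  idempotent from the right keeps the coefficients of the paths starting at \<open>v\<close> and kills the others.
\<close>

definition projective_at :: "'v \<Rightarrow> (('v, 'a) path \<Rightarrow>\<^sub>0 'k) set set"
  where "projective_at v =
    {X \<in> carrier A. \<forall>p. nonzero p \<and> path_source p \<noteq> v \<longrightarrow> coefficient X p = 0}"

lemma vertex_projective_eq:
  assumes "v \<in> verts Q"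
  shows "vertex_projective Q I v = left_ideal_module A (projective_at v)"
proof -
  have idem: "vertex_idempotent Q I v = path_class (trivial_path v)"
    by (simp add: vertex_idempotent_def path_class_def)
  have v: "trivial_path v \<in> paths Q" using assms by simp
  have coeff: "coefficient (X \<otimes>\<^bsub>A\<^esub> path_class (trivial_path v)) p =
      (if path_source p = v then coefficient X p else 0)" if "X \<in> carrier A" "nonzero p" for X p
    using coefficient_mult_path_class[OF that(1) v that(2)]
    by (auto, metis path_source_trivial)
  have "(\<lambda>X. X \<otimes>\<^bsub>A\<^esub> path_class (trivial_path v)) ` carrier A = projective_at v"
  proof (intro equalityI subsetI)
    fix X assume X: "X \<in> projective_at v"
    then have "X = X \<otimes>\<^bsub>A\<^esub> path_class (trivial_path v)"
      using v by (intro quotient_eqI) (auto simp: projective_at_def coeff)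
    then show "X \<in> (\<lambda>X. X \<otimes>\<^bsub>A\<^esub> path_class (trivial_path v)) ` carrier A"
      using X by (auto simp: projective_at_def)
  qed (use v in \<open>auto simp: projective_at_def coeff\<close>)
  then show ?thesis by (simp add: vertex_projective_def idem)
qed

lemma vertex_projective_dim_eq:
  assumes "v \<in> verts Q"
  shows "vertex_projective_dim Q I v = card {p. nonzero p \<and> path_source p = v}"
proof -
  have "finite {p. nonzero p \<and> path_source p = v}"
    by (rule finite_subset[OF _ finite_nonzero_paths]) auto
  then obtain ps where ps: "set ps = {p. nonzero p \<and> path_source p = v}" "distinct ps"
    using finite_distinct_list by blast
  have "A.Span (scalar_subfield Q I) (map path_class ps) = projective_at v"
    using ps by (subst span_path_classes) (auto simp: projective_at_def)
  then have "A.dimension (length (map path_class ps)) (scalar_subfield Q I) (projective_at v)"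
    using A.dimension_independent[OF independent_path_classes[of ps]] ps by simp
  moreover have "subfield (scalar_subfield Q I) A" using assms by (intro subfield_scalars) auto
  ultimately have "A.dim (scalar_subfield Q I) (projective_at v) = length (map path_class ps)"
    using A.dimI unfolding over_def by blast
  then show ?thesis
    using ps distinct_card[of ps]
    by (simp add: vertex_projective_dim_def vertex_projective_eq[OF assms] left_ideal_module_sel)
qed

section \<open>The radical of a vertex projective\<close>

text \<open>
  This left ideal turns out to be the only maximal submodule of the projective module at \<open>v\<close>.
\<close>

definition radical_at :: "'v \<Rightarrow> (('v, 'a) path \<Rightarrow>\<^sub>0 'k) set set"
  where "radical_at v = {X \<in> projective_at v. coefficient X (trivial_path v) = 0}"

lemma projective_at_closed: "X \<in> projective_at v \<Longrightarrow> X \<in> carrier A"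
  by (simp add: projective_at_def)

lemma left_ideal_projective_at: "A.left_ideal (projective_at v)"
proof (rule A.left_idealI)
  fix X Y assume X: "X \<in> carrier A" and Y: "Y \<in> projective_at v"
  have "coefficient (X \<otimes>\<^bsub>A\<^esub> Y) p = 0" if "nonzero p" "path_source p \<noteq> v" for p
    unfolding coefficient_mult[OF X projective_at_closed[OF Y] that(1)]
    using Y that nonzero_prefix[OF that(1)] by (intro sum.neutral) (auto simp: projective_at_def)
  then show "X \<otimes>\<^bsub>A\<^esub> Y \<in> projective_at v"
    using X Y by (auto simp: projective_at_def)
qed (auto simp: projective_at_def)

lemma coefficient_mult_trivial_path:
  assumes "X \<in> carrier A" "Y \<in> carrier A" "v \<in> verts Q"
  shows "coefficient (X \<otimes>\<^bsub>A\<^esub> Y) (trivial_path v) =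
    coefficient X (trivial_path v) * coefficient Y (trivial_path v)"
  using coefficient_mult[OF assms(1,2) nonzero_trivial_path[OF assms(3)]] by simp

lemma left_ideal_radical_at:
  assumes "v \<in> verts Q"
  shows "A.left_ideal (radical_at v)"
proof (rule A.left_idealI)
  note P = A.left_idealD[OF left_ideal_projective_at[of v]]
  show "radical_at v \<subseteq> carrier A" using P(1) by (auto simp: radical_at_def)
  show "\<zero>\<^bsub>A\<^esub> \<in> radical_at v"
    using P(2) assms by (simp add: radical_at_def nonzero_trivial_path)
  show "X \<oplus>\<^bsub>A\<^esub> Y \<in> radical_at v" if "X \<in> radical_at v" "Y \<in> radical_at v" for X Y
    using that P(1,3) assms by (auto simp: radical_at_def nonzero_trivial_path projective_at_closed)
  show "X \<otimes>\<^bsub>A\<^esub> Y \<in> radical_at v" if "X \<in> carrier A" "Y \<in> radical_at v" for X Y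
    using that P(1,4) assms
    by (auto simp: radical_at_def coefficient_mult_trivial_path projective_at_closed)
qed

lemma left_ideal_mem_if_path_classes:
  assumes H: "A.left_ideal H" and X: "X \<in> carrier A"
    and supp: "\<And>p. \<lbrakk>nonzero p; coefficient X p \<noteq> 0\<rbrakk> \<Longrightarrow> path_class p \<in> H"
  shows "X \<in> H"
proof -
  have comb: "combination (\<lambda>p. if p \<in> S then coefficient X p else 0) \<in> H"
    if "finite S" "S \<subseteq> {p. nonzero p \<and> coefficient X p \<noteq> 0}" for S
    using that
  proof (induction S)
    case empty
    have "combination (\<lambda>p. if p \<in> {} then coefficient X p else 0) = \<zero>\<^bsub>A\<^esub>"
      by (rule quotient_eqI) simp_all
    then show ?case using A.left_idealD(2)[OF H] by simp
  next
    case (insert p S)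
    have p: "nonzero p" "p \<in> paths Q" using insert.prems by (auto simp: nonzero_path_def)
    have "combination (\<lambda>q. if q \<in> insert p S then coefficient X q else 0) =
        scalar (coefficient X p) \<otimes>\<^bsub>A\<^esub> path_class p \<oplus>\<^bsub>A\<^esub>
        combination (\<lambda>q. if q \<in> S then coefficient X q else 0)"
      using insert.hyps(2) p by (intro quotient_eqI) auto
    moreover have "scalar (coefficient X p) \<otimes>\<^bsub>A\<^esub> path_class p \<in> H"
      using insert.prems p by (intro A.left_idealD(4)[OF H] supp) auto
    ultimately show ?case using insert by (simp add: A.left_idealD(3)[OF H])
  qed
  let ?S = "{p. nonzero p \<and> coefficient X p \<noteq> 0}"
  have "finite ?S" by (rule finite_subset[OF _ finite_nonzero_paths]) auto
  moreover have "X = combination (\<lambda>p. if p \<in> ?S then coefficient X p else 0)"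
    using X by (intro quotient_eqI) auto
  ultimately show ?thesis using comb[of ?S] by simp
qed

text \<open>
  An element with nonzero coefficient at the trivial path is, after scaling, the trivial path plus
  longer paths. Multiplying it by a path \<open>p\<close> from the left gives \<open>p\<close> plus longer paths. As the lengths
  of nonzero paths are bounded, descending induction on the length puts every path starting at \<open>v\<close>
  into the left ideal.
\<close>

lemma left_ideal_eq_projective_at:
  assumes v: "v \<in> verts Q" and H: "A.left_ideal H" "H \<subseteq> projective_at v"
    and X: "X \<in> H" "coefficient X (trivial_path v) \<noteq> 0"
  shows "H = projective_at v"
proof -
  obtain d where d: "\<And>p. nonzero p \<Longrightarrow> path_length p < d" using nonzero_paths_bounded by blast
  define Y where "Y = scalar (inverse (coefficient X (trivial_path v))) \<otimes>\<^bsub>A\<^esub> X"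
  have X_closed: "X \<in> carrier A" using A.left_idealD(1)[OF H(1)] X(1) by blast
  have Y: "Y \<in> H" "Y \<in> carrier A"
    unfolding Y_def using A.left_idealD(4)[OF H(1) _ X(1)] X_closed by auto
  have Y_triv: "coefficient Y (trivial_path v) = 1"
    unfolding Y_def using X X_closed v by (simp add: nonzero_trivial_path)
  have "path_class p \<in> H" if "nonzero p" "path_source p = v" for p
    using that
  proof (induction "d - path_length p" arbitrary: p rule: less_induct)
    case less
    have p: "p \<in> paths Q" using less.prems by (simp add: nonzero_path_def)
    have pY: "path_class p \<otimes>\<^bsub>A\<^esub> Y \<in> H" using A.left_idealD(4)[OF H(1) _ Y(1)] p by simp
    \<comment> \<open>The part of the product beyond its leading term \<open>p\<close>; it is supported on longer paths.\<close>
    let ?Z = "path_class p \<otimes>\<^bsub>A\<^esub> Y \<oplus>\<^bsub>A\<^esub> \<ominus>\<^bsub>A\<^esub> path_class p"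
    have "?Z \<in> H"
    proof (rule left_ideal_mem_if_path_classes[OF H(1)])
      show "?Z \<in> carrier A" using p Y by simp
      fix r assume r: "nonzero r" "coefficient ?Z r \<noteq> 0"
      let ?l = "path_length r - path_length p"
      have coeff: "coefficient (path_class p \<otimes>\<^bsub>A\<^esub> Y) r =
          (if path_suffix Q ?l r = p then coefficient Y (path_prefix ?l r) else 0)"
        by (rule coefficient_path_class_mult[OF Y(2) p r(1)])
      have "coefficient (path_class p \<otimes>\<^bsub>A\<^esub> Y) p = 1"
        using coefficient_path_class_mult[OF Y(2) p less.prems(1)] less.prems(2) Y_triv by simp
      then have "r \<noteq> p" using r p Y less.prems(1) by auto
      then have r': "path_suffix Q ?l r = p" "coefficient Y (path_prefix ?l r) \<noteq> 0"
        using r p Y coeff by (auto split: if_splits)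
      have "?l \<noteq> 0" using r' \<open>r \<noteq> p\<close> by (metis path_suffix_0)
      moreover have "path_source r = v"
      proof -
        have "\<forall>q. nonzero q \<and> path_source q \<noteq> v \<longrightarrow> coefficient Y q = 0"
          using Y(1) H(2) by (auto simp: projective_at_def)
        then show ?thesis using r'(2) nonzero_prefix[OF r(1)] by (metis path_source_prefix)
      qed
      ultimately show "path_class r \<in> H"
        using less.hyps[of r] r(1) d[OF r(1)] by auto
    qed
    then have "\<ominus>\<^bsub>A\<^esub> ?Z \<in> H"
      using H(1) subgroup.m_inv_closed[of H "add_monoid A" ?Z]
      by (simp add: A.left_ideal_def a_inv_def)
    then have "path_class p \<otimes>\<^bsub>A\<^esub> Y \<oplus>\<^bsub>A\<^esub> \<ominus>\<^bsub>A\<^esub> ?Z \<in> H"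
      using pY A.left_idealD(3)[OF H(1)] by blast
    moreover have "path_class p \<otimes>\<^bsub>A\<^esub> Y \<oplus>\<^bsub>A\<^esub> \<ominus>\<^bsub>A\<^esub> ?Z = path_class p"
      using p Y by (intro quotient_eqI) simp_all
    ultimately show ?case by simp
  qed
  note classes = this
  have "projective_at v \<subseteq> H"
  proof
    fix Z assume Z: "Z \<in> projective_at v"
    show "Z \<in> H"
    proof (rule left_ideal_mem_if_path_classes[OF H(1) projective_at_closed[OF Z]])
      fix p assume p: "nonzero p" "coefficient Z p \<noteq> 0"
      then have "path_source p = v" using Z unfolding projective_at_def by blast
      then show "path_class p \<in> H" by (rule classes[OF p(1)])
    qed
  qed
  then show ?thesis using H(2) by blast
qed

text \<open>
  A left ideal inside the projective module but not inside the radical is everything, so no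
  submodule lies properly between the two, and every proper submodule lies below the radical.
\<close>

lemma maximal_submodule_projective_at_iff:
  assumes v: "v \<in> verts Q"
  shows "maximal_submodule H A (left_ideal_module A (projective_at v)) \<longleftrightarrow> H = radical_at v"
proof -
  note sub = A.submodule_left_ideal_module_iff[OF left_ideal_projective_at[of v]]
  have "path_class (trivial_path v) \<in> projective_at v"
    using v by (auto simp: projective_at_def)
  moreover have "path_class (trivial_path v) \<notin> radical_at v"
    using v nonzero_trivial_path[OF v] by (simp add: radical_at_def)
  ultimately have proper: "radical_at v \<noteq> projective_at v" by blast
  have rad: "A.left_ideal (radical_at v)" "radical_at v \<subseteq> projective_at v"
    using left_ideal_radical_at[OF v] by (auto simp: radical_at_def)
  have below: "H \<subseteq> radical_at v \<or> H = projective_at v"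
    if "A.left_ideal H" "H \<subseteq> projective_at v" for H
    using left_ideal_eq_projective_at[OF v that] that(2) by (auto simp: radical_at_def)
  show ?thesis
    unfolding maximal_submodule_def sub left_ideal_module_sel
    using proper rad below by (metis subset_antisym)
qed

lemma module_radical_vertex_projective:
  assumes v: "v \<in> verts Q"
  shows "module_radical A (vertex_projective Q I v) = left_ideal_module A (radical_at v)"
proof -
  have "projective_at v \<inter> \<Inter> {H. maximal_submodule H A (left_ideal_module A (projective_at v))} =
      radical_at v"
    unfolding maximal_submodule_projective_at_iff[OF v] by (auto simp: radical_at_def)
  then show ?thesis
    by (simp add: module_radical_def vertex_projective_eq[OF v] left_ideal_module_def)
qed

section \<open>Projectivity of the radical\<close>

lemma arrow_class_in_radical_at:
  assumes "a \<in> paths Q" "path_length a = 1"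
  shows "path_class a \<in> radical_at (path_source a)"
proof -
  have "trivial_path (path_source a) \<noteq> a"
    by (metis assms(2) path_length_trivial zero_neq_one)
  then show ?thesis
    using assms(1) nonzero_trivial_path[OF path_source_in_verts[OF assms(1)]]
    by (auto simp: radical_at_def projective_at_def)
qed

text \<open>
  Every value \<open>f b\<close> annihilated by the nonzero path \<open>q\<close> has coefficient zero at the trivial path, since
  the product of \<open>q\<close> with \<open>f b\<close> has this coefficient at \<open>q\<close>. The image of \<open>f\<close> is a combination of
  elements of the radical with the coefficients \<open>f b\<close>; at an arrow \<open>a\<close> such a product can only have a
  nonzero coefficient if its left factor has one at the trivial path, as elements of the radical
  have none. The induction removes one basis element from the support of \<open>f\<close> at a time.
\<close>

lemma coefficient_arrow_of_free_module_image:
  assumes a: "a \<in> paths Q" "path_source a = v" "path_length a = 1"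
    and q: "nonzero q" "path_source q = path_target Q a"
    and pr: "pr \<in> module_hom A (free_module A B) (left_ideal_module A (radical_at v))"
    and f: "f \<in> carrier (free_module A B)" "\<And>b. path_class q \<otimes>\<^bsub>A\<^esub> f b = \<zero>\<^bsub>A\<^esub>"
  shows "coefficient (pr f) a = 0"
proof -
  let ?w = "path_target Q a"
  let ?F = "carrier (free_module A B)"
  have pr_add: "pr (\<lambda>b. f b \<oplus>\<^bsub>A\<^esub> g b) = pr f \<oplus>\<^bsub>A\<^esub> pr g" if "f \<in> ?F" "g \<in> ?F" for f g
    using pr that by (auto simp: module_hom_def left_ideal_module_sel free_module_def)
  have pr_smult: "pr (\<lambda>b. X \<otimes>\<^bsub>A\<^esub> f b) = X \<otimes>\<^bsub>A\<^esub> pr f" if "X \<in> carrier A" "f \<in> ?F" for X f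
    using pr that by (auto simp: module_hom_def left_ideal_module_sel free_module_def)
  have pr_closed: "pr f \<in> radical_at v" if "f \<in> ?F" for f
    using pr that by (auto simp: module_hom_def left_ideal_module_sel)
  have rad_closed: "X \<in> carrier A" if "X \<in> radical_at v" for X
    using that by (simp add: radical_at_def projective_at_def)
  have F_iff: "f \<in> ?F \<longleftrightarrow> (\<forall>b\<in>B. f b \<in> carrier A) \<and> (\<forall>b. b \<notin> B \<longrightarrow> f b = \<zero>\<^bsub>A\<^esub>) \<and>
      finite {b. f b \<noteq> \<zero>\<^bsub>A\<^esub>}" for f
    by (simp add: free_module_def)
  have a_nz: "nonzero a" using a by (simp add: nonzero_if_short)
  have q_path: "q \<in> paths Q" using q by (simp add: nonzero_path_def)
  show ?thesis
    using f
  proof (induction "card {b. f b \<noteq> \<zero>\<^bsub>A\<^esub>}" arbitrary: f)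
    case 0
    then have f0: "f b = \<zero>\<^bsub>A\<^esub>" for b using F_iff by auto
    have ff: "(\<lambda>b. f b \<oplus>\<^bsub>A\<^esub> f b) = f" by (rule ext) (simp add: f0)
    have "pr f \<in> carrier A" by (rule rad_closed[OF pr_closed[OF 0(2)]])
    then have "coefficient (pr f \<oplus>\<^bsub>A\<^esub> pr f) a = coefficient (pr f) a + coefficient (pr f) a"
      using a_nz by simp
    moreover have "pr f \<oplus>\<^bsub>A\<^esub> pr f = pr f" using pr_add[OF 0(2,2)] unfolding ff by (rule sym)
    ultimately show ?case by (simp only: add_cancel_right_right)
  next
    case (Suc n)
    have fin: "finite {b. f b \<noteq> \<zero>\<^bsub>A\<^esub>}" using Suc.prems(1) F_iff by blast
    obtain b where b: "f b \<noteq> \<zero>\<^bsub>A\<^esub>"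
      using Suc.hyps(2) by (metis (mono_tags, lifting) Collect_empty_eq card.empty nat.distinct(1))
    have bB: "b \<in> B" "f b \<in> carrier A" using b Suc.prems(1) F_iff by auto
    define e where "e = (\<lambda>b'. if b' = b then \<one>\<^bsub>A\<^esub> else \<zero>\<^bsub>A\<^esub>)"
    define g where "g = f(b := \<zero>\<^bsub>A\<^esub>)"
    have e: "e \<in> ?F"
      using bB by (auto simp: F_iff e_def intro: finite_subset[of _ "{b}"])
    have fe: "(\<lambda>b'. f b \<otimes>\<^bsub>A\<^esub> e b') \<in> ?F"
      using bB by (auto simp: F_iff e_def intro: finite_subset[of _ "{b}"])
    have supp: "{b'. g b' \<noteq> \<zero>\<^bsub>A\<^esub>} = {b'. f b' \<noteq> \<zero>\<^bsub>A\<^esub>} - {b}" by (auto simp: g_def)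
    have g: "g \<in> ?F" using Suc.prems(1) bB fin by (simp add: F_iff supp) (simp add: g_def)
    have "card {b'. g b' \<noteq> \<zero>\<^bsub>A\<^esub>} = n" unfolding supp using b Suc.hyps(2) fin by simp
    moreover have "path_class q \<otimes>\<^bsub>A\<^esub> g b' = \<zero>\<^bsub>A\<^esub>" for b'
      using Suc.prems(2) q_path by (simp add: g_def)
    ultimately have IH: "coefficient (pr g) a = 0" using Suc.hyps(1) g by metis
    have "f = (\<lambda>b'. (f b \<otimes>\<^bsub>A\<^esub> e b') \<oplus>\<^bsub>A\<^esub> g b')"
    proof
      fix b' show "f b' = (f b \<otimes>\<^bsub>A\<^esub> e b') \<oplus>\<^bsub>A\<^esub> g b'"
        using bB Suc.prems(1) by (cases "b' \<in> B") (auto simp: e_def g_def F_iff)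
    qed
    then have "pr f = pr (\<lambda>b'. (f b \<otimes>\<^bsub>A\<^esub> e b') \<oplus>\<^bsub>A\<^esub> g b')" by (rule arg_cong)
    also have "\<dots> = f b \<otimes>\<^bsub>A\<^esub> pr e \<oplus>\<^bsub>A\<^esub> pr g"
      using pr_add[OF fe g] pr_smult[OF bB(2) e] by simp
    finally have pr_f: "pr f = f b \<otimes>\<^bsub>A\<^esub> pr e \<oplus>\<^bsub>A\<^esub> pr g" .
    have "coefficient (f b) (trivial_path ?w) = coefficient (path_class q \<otimes>\<^bsub>A\<^esub> f b) q"
      using coefficient_path_class_mult[OF bB(2) q_path q(1)] q(2) by simp
    then have fb: "coefficient (f b) (trivial_path ?w) = 0"
      using Suc.prems(2) q(1) by simp
    have pe: "coefficient (pr e) (trivial_path v) = 0"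
      using pr_closed[OF e] by (simp add: radical_at_def)
    have "{..path_length a} = {0, 1}" using a(3) by auto
    then have "coefficient (f b \<otimes>\<^bsub>A\<^esub> pr e) a = 0"
      unfolding coefficient_mult[OF bB(2) rad_closed[OF pr_closed[OF e]] a_nz]
      using fb pe a(2,3) path_suffix_length[of Q a] path_prefix_length[of a] by simp
    then show ?case
      unfolding pr_f using IH a_nz bB rad_closed pr_closed e g by simp
  qed
qed

text \<open>
  If the product of \<open>q\<close> with \<open>a\<close> is zero, then \<open>q\<close> annihilates the image of \<open>a\<close> in the free module.
  Projecting back to the radical would give an element without coefficient at \<open>a\<close>, but it is \<open>a\<close>.
\<close>

lemma concat_nonzero_if_radical_projective:
  assumes v: "v \<in> verts Q" and a: "a \<in> paths Q" "path_source a = v" "path_length a = 1"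
    and proj: "projective_module A (left_ideal_module A (radical_at v))"
    and q: "nonzero q" "path_source q = path_target Q a"
  shows "nonzero (path_concat q a)"
proof (rule ccontr)
  let ?M = "left_ideal_module A (radical_at v)"
  assume "\<not> nonzero (path_concat q a)"
  then have zero: "path_class q \<otimes>\<^bsub>A\<^esub> path_class a = \<zero>\<^bsub>A\<^esub>"
  proof (intro quotient_eqI)
    fix p assume p: "nonzero p"
    have qa: "q \<in> paths Q" using q by (simp add: nonzero_path_def)
    assume nz: "\<not> nonzero (path_concat q a)"
    have "path_prefix (path_length a) p \<noteq> a \<or> path_suffix Q (path_length a) p \<noteq> q"
      using nz p by (metis path_concat_suffix_prefix)
    then show "coefficient (path_class q \<otimes>\<^bsub>A\<^esub> path_class a) p = coefficient \<zero>\<^bsub>A\<^esub> p"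
      using p qa a nonzero_suffix[OF p] by (auto simp: coefficient_mult_path_class)
  qed (use q a in \<open>auto simp: nonzero_path_def\<close>)
  have a_nz: "nonzero a" using a by (simp add: nonzero_if_short)
  have q_path: "q \<in> paths Q" using q by (simp add: nonzero_path_def)
  obtain B :: "(('v, 'a) path \<Rightarrow>\<^sub>0 'k) set set" and incl pr where
    incl: "incl \<in> module_hom A ?M (free_module A B)" and
    pr: "pr \<in> module_hom A (free_module A B) ?M" and
    split: "\<And>X. X \<in> radical_at v \<Longrightarrow> pr (incl X) = X"
    using proj unfolding projective_module_def left_ideal_module_sel
    by (elim conjE exE) (rule that, assumption, assumption, blast)
  let ?F = "carrier (free_module A B)"
  have a_rad: "path_class a \<in> radical_at v"
    using arrow_class_in_radical_at[OF a(1,3)] a(2) by simp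
  have F: "incl (path_class a) \<in> ?F"
    using incl a_rad by (auto simp: module_hom_def left_ideal_module_sel)
  have incl_smult: "incl (X \<otimes>\<^bsub>A\<^esub> Y) = (\<lambda>b. X \<otimes>\<^bsub>A\<^esub> incl Y b)"
    if "X \<in> carrier A" "Y \<in> radical_at v" for X Y
    using incl that by (auto simp: module_hom_def left_ideal_module_sel free_module_def)
  have "incl (path_class q \<otimes>\<^bsub>A\<^esub> path_class a) = (\<lambda>b. path_class q \<otimes>\<^bsub>A\<^esub> incl (path_class a) b)"
    by (rule incl_smult[OF path_class_closed[OF q_path] a_rad])
  moreover have "incl \<zero>\<^bsub>A\<^esub> = (\<lambda>b. \<zero>\<^bsub>A\<^esub> \<otimes>\<^bsub>A\<^esub> incl (path_class a) b)"
    using incl_smult[OF A.zero_closed a_rad] unfolding A.l_null[OF path_class_closed[OF a(1)]] .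
  moreover have "incl (path_class a) b \<in> carrier A" for b
    using F by (cases "b \<in> B") (auto simp: free_module_def)
  ultimately have "path_class q \<otimes>\<^bsub>A\<^esub> incl (path_class a) b = \<zero>\<^bsub>A\<^esub>" for b
    using zero by (metis A.l_null)
  then have "coefficient (pr (incl (path_class a))) a = 0"
    by (rule coefficient_arrow_of_free_module_image[OF a q pr F])
  then show False using split[OF a_rad] a a_nz by simp
qed

text \<open>
  When \<open>a\<close> is the only arrow leaving \<open>v\<close>, every element of the radical is a right multiple of \<open>a\<close>; when
  no nonzero path starting at the target of \<open>a\<close> is annihilated by \<open>a\<close>, the left factor is unique among
  the elements supported on such paths. Division by \<open>a\<close> is then linear and embeds the radical into the free
  module of rank one, with right multiplication by \<open>a\<close> as retraction.
\<close>

lemma radical_projective_if_concat_nonzero: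
  assumes v: "v \<in> verts Q" and a: "a \<in> paths Q" "path_source a = v" "path_length a = 1"
    and unique: "\<And>p. \<lbrakk>p \<in> paths Q; path_source p = v; path_length p = 1\<rbrakk> \<Longrightarrow> p = a"
    and inj: "\<And>q. \<lbrakk>nonzero q; path_source q = path_target Q a\<rbrakk> \<Longrightarrow> nonzero (path_concat q a)"
  shows "projective_module A (left_ideal_module A (radical_at v))"
proof -
  let ?M = "left_ideal_module A (radical_at v)" and ?w = "path_target Q a"
  have w: "?w \<in> verts Q" using a(1) by (rule path_target_in_verts)
  have coeff: "coefficient (Y \<otimes>\<^bsub>A\<^esub> path_class a) p =
      (if path_prefix 1 p = a then coefficient Y (path_suffix Q 1 p) else 0)"
    if "Y \<in> carrier A" "nonzero p" for Y p
    using coefficient_mult_path_class[OF that(1) a(1) that(2)] a(3) by simp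
  have prefix: "path_prefix 1 p = a" if "nonzero p" "path_source p = v" "path_length p \<noteq> 0" for p
    using that nonzero_prefix[OF that(1), of 1] by (intro unique) (auto simp: nonzero_path_def)
  have ex: "\<exists>Y\<in>projective_at ?w. Y \<otimes>\<^bsub>A\<^esub> path_class a = X" if X: "X \<in> radical_at v" for X
  proof
    let ?Y = "combination (\<lambda>r. if path_source r = ?w then coefficient X (path_concat r a) else 0)"
    show "?Y \<in> projective_at ?w" by (simp add: projective_at_def)
    show "?Y \<otimes>\<^bsub>A\<^esub> path_class a = X"
    proof (rule quotient_eqI)
      fix p assume p: "nonzero p"
      have "coefficient X p = 0" if "path_prefix 1 p \<noteq> a"
      proof (cases "path_source p = v")
        case True
        then have "p = trivial_path v" using prefix[OF p] that by (metis path_length_0_iff)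
        then show ?thesis using X by (simp add: radical_at_def)
      qed (use X p in \<open>auto simp: radical_at_def projective_at_def\<close>)
      moreover have "coefficient X (path_concat (path_suffix Q 1 p) a) = coefficient X p"
        if "path_prefix 1 p = a"
        using that path_concat_suffix_prefix[of Q 1 p] by simp
      ultimately show "coefficient (?Y \<otimes>\<^bsub>A\<^esub> path_class a) p = coefficient X p"
        using p nonzero_suffix[OF p, of 1] by (auto simp: coeff)
    qed (use X a in \<open>auto simp: radical_at_def projective_at_def\<close>)
  qed
  have uniq: "Y = Z"
    if "Y \<in> projective_at ?w" "Z \<in> projective_at ?w" "Y \<otimes>\<^bsub>A\<^esub> path_class a = Z \<otimes>\<^bsub>A\<^esub> path_class a" for Y Z
  proof (rule quotient_eqI)
    fix q assume q: "nonzero q"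
    show "coefficient Y q = coefficient Z q"
    proof (cases "path_source q = ?w")
      case True
      have "path_prefix 1 (path_concat q a) = a" "path_suffix Q 1 (path_concat q a) = q"
        using path_prefix_concat[of a q] path_suffix_concat[OF True] a(3) by simp_all
      then show ?thesis
        using that inj[OF q True] coeff[of Y "path_concat q a"] coeff[of Z "path_concat q a"]
        by (simp add: projective_at_def)
    qed (use that q in \<open>auto simp: projective_at_def\<close>)
  qed (use that in \<open>auto simp: projective_at_def\<close>)
  define divide where "divide X = (THE Y. Y \<in> projective_at ?w \<and> Y \<otimes>\<^bsub>A\<^esub> path_class a = X)" for X
  have divide: "divide X \<in> projective_at ?w" "divide X \<otimes>\<^bsub>A\<^esub> path_class a = X"
    if "X \<in> radical_at v" for X
  proof -
    have "\<exists>!Y. Y \<in> projective_at ?w \<and> Y \<otimes>\<^bsub>A\<^esub> path_class a = X"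
      using ex[OF that] uniq by auto
    then have "divide X \<in> projective_at ?w \<and> divide X \<otimes>\<^bsub>A\<^esub> path_class a = X"
      unfolding divide_def by (rule theI')
    then show "divide X \<in> projective_at ?w" "divide X \<otimes>\<^bsub>A\<^esub> path_class a = X" by auto
  qed
  note rad = A.left_idealD[OF left_ideal_radical_at[OF v]]
  note P = A.left_idealD[OF left_ideal_projective_at[of ?w]]
  have divide_add: "divide (X \<oplus>\<^bsub>A\<^esub> Y) = divide X \<oplus>\<^bsub>A\<^esub> divide Y"
    if "X \<in> radical_at v" "Y \<in> radical_at v" for X Y
  proof (rule uniq)
    have "(divide X \<oplus>\<^bsub>A\<^esub> divide Y) \<otimes>\<^bsub>A\<^esub> path_class a =
        divide X \<otimes>\<^bsub>A\<^esub> path_class a \<oplus>\<^bsub>A\<^esub> divide Y \<otimes>\<^bsub>A\<^esub> path_class a"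
      by (intro A.l_distr projective_at_closed[OF divide(1)] that path_class_closed a(1))
    then show "divide (X \<oplus>\<^bsub>A\<^esub> Y) \<otimes>\<^bsub>A\<^esub> path_class a =
        (divide X \<oplus>\<^bsub>A\<^esub> divide Y) \<otimes>\<^bsub>A\<^esub> path_class a"
      by (simp only: divide(2) that rad(3))
  qed (intro divide(1) P(3) rad(3) that)+
  have divide_smult: "divide (X \<otimes>\<^bsub>A\<^esub> Y) = X \<otimes>\<^bsub>A\<^esub> divide Y"
    if "X \<in> carrier A" "Y \<in> radical_at v" for X Y
  proof (rule uniq)
    have "(X \<otimes>\<^bsub>A\<^esub> divide Y) \<otimes>\<^bsub>A\<^esub> path_class a = X \<otimes>\<^bsub>A\<^esub> (divide Y \<otimes>\<^bsub>A\<^esub> path_class a)"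
      by (intro A.m_assoc projective_at_closed[OF divide(1)] that path_class_closed a(1))
    then show "divide (X \<otimes>\<^bsub>A\<^esub> Y) \<otimes>\<^bsub>A\<^esub> path_class a = (X \<otimes>\<^bsub>A\<^esub> divide Y) \<otimes>\<^bsub>A\<^esub> path_class a"
      by (simp only: divide(2) that rad(4))
  qed (intro divide(1) P(4) rad(4) that)+
  have a_rad: "path_class a \<in> radical_at v"
    using arrow_class_in_radical_at[OF a(1,3)] a(2) by simp
  \<comment> \<open>The basis is a single element; the class of \<open>a\<close> serves only as its label.\<close>
  define b where "b = path_class a"
  define incl where "incl X = (\<lambda>b'. if b' = b then divide X else \<zero>\<^bsub>A\<^esub>)" for X
  define pr where "pr f = f b \<otimes>\<^bsub>A\<^esub> path_class a" for f :: "_ \<Rightarrow> (('v, 'a) path \<Rightarrow>\<^sub>0 'k) set"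
  have incl_closed: "incl X \<in> carrier (free_module A {b})" if "X \<in> radical_at v" for X
  proof -
    have "finite {b'. incl X b' \<noteq> \<zero>\<^bsub>A\<^esub>}"
      by (rule finite_subset[of _ "{b}"]) (auto simp: incl_def)
    then show ?thesis
      using projective_at_closed[OF divide(1)[OF that]] by (simp add: free_module_def incl_def)
  qed
  have incl_add: "incl (X \<oplus>\<^bsub>A\<^esub> Y) = (\<lambda>b'. incl X b' \<oplus>\<^bsub>A\<^esub> incl Y b')"
    if "X \<in> radical_at v" "Y \<in> radical_at v" for X Y
    by (rule ext) (simp add: incl_def divide_add that)
  have incl_smult: "incl (X \<otimes>\<^bsub>A\<^esub> Y) = (\<lambda>b'. X \<otimes>\<^bsub>A\<^esub> incl Y b')"
    if "X \<in> carrier A" "Y \<in> radical_at v" for X Y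
    by (rule ext) (simp add: incl_def divide_smult that)
  have free: "f \<oplus>\<^bsub>free_module A {b}\<^esub> g = (\<lambda>b'. f b' \<oplus>\<^bsub>A\<^esub> g b')"
    "X \<odot>\<^bsub>free_module A {b}\<^esub> f = (\<lambda>b'. X \<otimes>\<^bsub>A\<^esub> f b')" for f g X
    by (simp_all add: free_module_def)
  have "incl \<in> module_hom A ?M (free_module A {b})"
    unfolding module_hom_def left_ideal_module_sel free
    using incl_closed incl_add incl_smult by blast
  moreover have "pr \<in> module_hom A (free_module A {b}) ?M"
    using rad(4)[OF _ a_rad] a(1)
    by (auto simp: module_hom_def left_ideal_module_sel free_module_def pr_def A.l_distr A.m_assoc)
  moreover have "\<forall>X\<in>carrier ?M. pr (incl X) = X"
    using divide by (simp add: left_ideal_module_sel pr_def incl_def)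
  ultimately show ?thesis
    using A.left_module_left_ideal[OF left_ideal_radical_at[OF v]]
    unfolding projective_module_def by blast
qed

lemma black_vertex_iff:
  assumes v: "v \<in> verts Q" and a: "a \<in> paths Q" "path_source a = v" "path_length a = 1"
    and unique: "\<And>p. \<lbrakk>p \<in> paths Q; path_source p = v; path_length p = 1\<rbrakk> \<Longrightarrow> p = a"
  shows "black_vertex Q I v \<longleftrightarrow>
    (\<exists>q. nonzero q \<and> path_source q = path_target Q a \<and> \<not> nonzero (path_concat q a))"
proof -
  have "projective_module A (left_ideal_module A (radical_at v)) \<longleftrightarrow>
      (\<forall>q. nonzero q \<and> path_source q = path_target Q a \<longrightarrow> nonzero (path_concat q a))"
    using concat_nonzero_if_radical_projective[OF v a] radical_projective_if_concat_nonzero[OF v a unique] by blast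
  then show ?thesis
    unfolding black_vertex_def Let_def module_radical_vertex_projective[OF v] by blast
qed

end

section \<open>Paths on the basic cycle\<close>

lemma residue_vertex_eq:
  assumes "n \<ge> 1"
  shows "residue_vertex n m = nat ((m - 1) mod int n) + 1"
  unfolding residue_vertex_def
proof (rule the_equality)
  have range: "0 \<le> (m - 1) mod int n" "(m - 1) mod int n < int n" using assms by auto
  have "((m - 1) mod int n + 1) mod int n = m mod int n" by (simp add: mod_add_left_eq)
  then show "1 \<le> nat ((m - 1) mod int n) + 1 \<and> nat ((m - 1) mod int n) + 1 \<le> n \<and>
      m mod int n = int (nat ((m - 1) mod int n) + 1) mod int n"
    using range by (auto simp: nat_less_iff add.commute)
next
  fix j :: nat
  assume j: "1 \<le> j \<and> j \<le> n \<and> m mod int n = int j mod int n"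
  then have "(m - 1) mod int n = (int j - 1) mod int n" by (metis mod_diff_left_eq)
  then show "j = nat ((m - 1) mod int n) + 1" using j by (simp add: nat_diff_distrib)
qed

definition cycle_shift :: "nat \<Rightarrow> nat \<Rightarrow> nat \<Rightarrow> nat"
  where "cycle_shift n v k = residue_vertex n (int v + int k)"

lemma cycle_shift_in_range: "n \<ge> 1 \<Longrightarrow> cycle_shift n v k \<in> {1..n}"
  by (auto simp: cycle_shift_def residue_vertex_eq nat_less_iff Suc_le_eq)

lemma cycle_shift_0: "v \<in> {1..n} \<Longrightarrow> cycle_shift n v 0 = v"
  by (auto simp: cycle_shift_def residue_vertex_eq nat_diff_distrib)

lemma cycle_shift_shift: "n \<ge> 1 \<Longrightarrow> cycle_shift n (cycle_shift n v k) l = cycle_shift n v (k + l)"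
proof -
  assume n: "n \<ge> 1"
  have "((int v + int k - 1) mod int n + int l) mod int n = (int v + int (k + l) - 1) mod int n"
    unfolding mod_add_left_eq by (simp add: algebra_simps)
  then show ?thesis using n by (simp add: cycle_shift_def residue_vertex_eq)
qed

text \<open>
  Going on for \<open>n * k - k\<close> steps completes \<open>k\<close> full turns and thereby undoes a shift by \<open>k\<close>.
\<close>

lemma cycle_shift_inj:
  assumes "n \<ge> 1" "v \<in> {1..n}" "w \<in> {1..n}" "cycle_shift n v k = cycle_shift n w k"
  shows "v = w"
proof -
  have inv: "cycle_shift n (cycle_shift n u k) (n * k - k) = u" if "u \<in> {1..n}" for u
  proof -
    have "k \<le> n * k" using assms(1) by simp
    then have "cycle_shift n (cycle_shift n u k) (n * k - k) = cycle_shift n u (n * k)"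
      using assms(1) by (simp add: cycle_shift_shift)
    also have "\<dots> = cycle_shift n u 0"
    proof -
      have "int u + int (n * k) - 1 = (int u + int 0 - 1) + int k * int n" by simp
      then have "(int u + int (n * k) - 1) mod int n = (int u + int 0 - 1) mod int n"
        by (simp only: mod_mult_self1)
      then show ?thesis using assms(1) by (simp add: cycle_shift_def residue_vertex_eq)
    qed
    finally show ?thesis using cycle_shift_0[OF that] by simp
  qed
  show ?thesis using inv[OF assms(2)] inv[OF assms(3)] unfolding assms(4) by (rule trans[OF sym])
qed

lemma basic_cycle_sel:
  "verts (basic_cycle n) = {1..n}" "arcs (basic_cycle n) = {1..n}"
  "tail (basic_cycle n) i = i" "head (basic_cycle n) i = cycle_shift n i 1"
  by (simp_all add: basic_cycle_def cycle_shift_def)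

lemma fin_digraph_basic_cycle: "n \<ge> 1 \<Longrightarrow> fin_digraph (basic_cycle n)"
proof unfold_locales
  fix e assume "n \<ge> 1" "e \<in> arcs (basic_cycle n)"
  then show "tail (basic_cycle n) e \<in> verts (basic_cycle n)"
    "head (basic_cycle n) e \<in> verts (basic_cycle n)"
    using cycle_shift_in_range[of n e 1] by (simp_all only: basic_cycle_sel)
qed (simp_all add: basic_cycle_sel)

locale cyclic_monomial_algebra =
  fixes n :: nat and I :: "((nat, nat) path \<Rightarrow>\<^sub>0 'k::field) set"
  assumes n_pos: "n \<ge> 1" and monomial_cycle: "monomial_ideal (basic_cycle n) I"

sublocale cyclic_monomial_algebra \<subseteq> monomial_algebra "basic_cycle n" I
  by (simp add: monomial_algebra_def monomial_algebra_axioms_def fin_digraph_basic_cycle[OF n_pos] monomial_cycle)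

context cyclic_monomial_algebra
begin

abbreviation "shift \<equiv> cycle_shift n"
abbreviation "target \<equiv> path_target (basic_cycle n)"
abbreviation "black \<equiv> black_vertex (basic_cycle n) I"
abbreviation "\<theta> \<equiv> theta n I"
abbreviation "cdim \<equiv> vertex_projective_dim (basic_cycle n) I"

definition cpath :: "nat \<Rightarrow> nat \<Rightarrow> (nat, nat) path"
  where "cpath v l = (v, map (shift v) [0..<l])"

lemmas shift_shift [simp] = cycle_shift_shift[OF n_pos]
lemmas shift_0 [simp] = cycle_shift_0[of _ n]

lemma shift_in_range [simp]: "shift v k \<in> {1..n}"
  by (rule cycle_shift_in_range[OF n_pos])

lemma shift_bounds [simp]: "Suc 0 \<le> shift v k" "0 < shift v k" "shift v k \<le> n"
  using shift_in_range[of v k] by simp_all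

lemma path_source_cpath [simp]: "path_source (cpath v l) = v"
  by (simp add: path_source_def cpath_def)

lemma path_length_cpath [simp]: "path_length (cpath v l) = l"
  by (simp add: path_length_def cpath_def)

lemma target_cpath [simp]: "v \<in> {1..n} \<Longrightarrow> target (cpath v l) = shift v l"
  by (simp add: path_target_def cpath_def pre_digraph.awalk_verts_conv basic_cycle_sel last_map)

lemma cpath_eq_iff [simp]: "cpath v l = cpath w m \<longleftrightarrow> v = w \<and> l = m"
  by (metis path_source_cpath path_length_cpath)

lemma path_concat_cpath [simp]:
  "path_concat (cpath (shift v l) m) (cpath v l) = cpath v (l + m)"
proof -
  have "map (shift v) [0..<l + m] = map (shift v) [0..<l] @ map (shift v) [l..<l + m]"
    using upt_add_eq_append[of 0 l m] by simp
  also have "[l..<l + m] = map (\<lambda>k. k + l) [0..<m]"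
    unfolding map_add_upt by (simp only: add.commute)
  also have "map (shift v) \<dots> = map (shift (shift v l)) [0..<m]"
    unfolding map_map by (rule map_cong[OF refl]) (simp add: add.commute)
  finally show ?thesis by (simp add: path_concat_def cpath_def)
qed

lemma cas_basic_cycleD:
  "pre_digraph.cas (basic_cycle n) v xs w \<Longrightarrow> v \<in> {1..n} \<Longrightarrow> xs = map (shift v) [0..<length xs]"
proof (induction xs arbitrary: v)
  case Nil
  then show ?case by simp
next
  case (Cons x xs)
  have x: "x = v" "pre_digraph.cas (basic_cycle n) (shift v 1) xs w"
    using Cons.prems(1) by (auto simp: pre_digraph.cas.simps basic_cycle_sel)
  have "xs = map (shift (shift v 1)) [0..<length xs]" by (rule Cons.IH[OF x(2)]) simp
  also have "\<dots> = map (shift v) (map Suc [0..<length xs])"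
    unfolding map_map by (rule map_cong[OF refl]) simp
  also have "\<dots> = map (shift v) [1..<length (x # xs)]" unfolding map_Suc_upt by simp
  finally have "x # xs = map (shift v) (0 # [1..<length (x # xs)])" using x Cons.prems(2) by simp
  also have "0 # [1..<length (x # xs)] = [0..<length (x # xs)]"
    unfolding One_nat_def by (rule upt_conv_Cons[symmetric]) simp
  finally show ?case .
qed

lemma cpath_in_paths [simp]: "v \<in> {1..n} \<Longrightarrow> cpath v l \<in> paths (basic_cycle n)"
proof (induction l)
  case 0
  then show ?case
    by (simp add: cpath_def basic_cycle_sel trivial_path_in_paths[unfolded trivial_path_def])
next
  case (Suc l)
  have one: "cpath w 1 \<in> paths (basic_cycle n)" if "w \<in> {1..n}" for w
    using that by (simp add: cpath_def paths_def path_source_def path_target_def awalk_def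
        basic_cycle_sel pre_digraph.cas.simps pre_digraph.awalk_verts.simps)
  have "path_concat (cpath (shift v l) 1) (cpath v l) \<in> paths (basic_cycle n)"
    using Suc one[of "shift v l"] by (subst path_concat_in_paths) simp_all
  then show ?case by simp
qed

lemma path_eq_cpath:
  assumes "p \<in> paths (basic_cycle n)"
  shows "p = cpath (path_source p) (path_length p)" "path_source p \<in> {1..n}"
proof -
  show v: "path_source p \<in> {1..n}"
    using path_source_in_verts[OF assms] by (simp add: basic_cycle_sel)
  show "p = cpath (path_source p) (path_length p)"
    using assms v cas_basic_cycleD[of "path_source p" "snd p" "target p"]
    by (cases p) (auto simp: paths_def awalk_def cpath_def path_source_def path_length_def)
qed

text \<open>
  The nonzero paths with source \<open>v\<close> form an initial segment, ordered by length, because prefixes of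
  nonzero paths are nonzero. Its size is their number, which is the dimension.
\<close>

lemma nonzero_cpath_iff:
  assumes v: "v \<in> {1..n}"
  shows "nonzero (cpath v l) \<longleftrightarrow> l < cdim v"
proof -
  define c where "c = (LEAST l. \<not> nonzero (cpath v l))"
  have "\<exists>l. \<not> nonzero (cpath v l)"
    using nonzero_paths_bounded by (metis less_irrefl path_length_cpath)
  then have c: "\<not> nonzero (cpath v c)" unfolding c_def by (rule LeastI_ex)
  have nz: "nonzero (cpath v l) \<longleftrightarrow> l < c" for l
  proof
    assume l: "nonzero (cpath v l)"
    show "l < c"
    proof (rule ccontr)
      assume "\<not> l < c"
      then have "nonzero (path_concat (cpath (shift v c) (l - c)) (cpath v c))" using l by simp
      then have "nonzero (cpath v c)"
        by (rule nonzero_path_concatD(2)) (use v in simp)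
      then show False using c by simp
    qed
  next
    assume "l < c"
    then show "nonzero (cpath v l)" unfolding c_def using not_less_Least by blast
  qed
  have "{p. nonzero p \<and> path_source p = v} = cpath v ` {..<c}"
  proof (intro equalityI subsetI)
    fix p assume "p \<in> {p. nonzero p \<and> path_source p = v}"
    then have "p = cpath v (path_length p)" "nonzero p"
      using path_eq_cpath[of p] by (auto simp: nonzero_path_def)
    then show "p \<in> cpath v ` {..<c}" by (metis image_eqI lessThan_iff nz)
  next
    fix p assume "p \<in> cpath v ` {..<c}"
    then obtain l where "p = cpath v l" "l < c" by blast
    then show "p \<in> {p. nonzero p \<and> path_source p = v}" using nz[of l] by simp
  qed
  then have "cdim v = c"
    using v by (simp add: vertex_projective_dim_eq basic_cycle_sel card_image inj_on_def)
  then show ?thesis using nz by simp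
qed

lemma nonzero_iff:
  "nonzero p \<longleftrightarrow> p \<in> paths (basic_cycle n) \<and> path_length p < cdim (path_source p)"
  by (metis path_eq_cpath nonzero_cpath_iff nonzero_path_in_paths)

lemma cdim_ge_2: "v \<in> {1..n} \<Longrightarrow> cdim v \<ge> 2"
  using nonzero_if_short[of "cpath v 1"] nonzero_cpath_iff[of v 1] by simp

text \<open>
  Otherwise there would be a nonzero path from \<open>v\<close> whose part after the first \<open>k\<close> arrows is too long
  to be nonzero.
\<close>

lemma cdim_shift_le:
  assumes v: "v \<in> {1..n}"
  shows "cdim v \<le> cdim (shift v k) + k"
proof (rule ccontr)
  assume "\<not> cdim v \<le> cdim (shift v k) + k"
  then have "nonzero (cpath v (k + cdim (shift v k)))" using v by (simp add: nonzero_cpath_iff)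
  then have "nonzero (path_concat (cpath (shift v k) (cdim (shift v k))) (cpath v k))" by simp
  then have "nonzero (cpath (shift v k) (cdim (shift v k)))"
    by (rule nonzero_path_concatD(1)) (use v in simp)
  then show False using nonzero_cpath_iff[of "shift v k"] by simp
qed

text \<open>
  The longest nonzero path starting at the next vertex is the one to test: its product with the
  arrow is zero exactly when \<open>cdim v \<le> cdim (shift v 1)\<close>.
\<close>

lemma black_iff:
  assumes v: "v \<in> {1..n}"
  shows "black v \<longleftrightarrow> cdim v \<le> cdim (shift v 1)"
proof -
  have "black v \<longleftrightarrow> (\<exists>q. nonzero q \<and> path_source q = target (cpath v 1) \<and>
      \<not> nonzero (path_concat q (cpath v 1)))"
  proof (rule black_vertex_iff)
    fix p assume "p \<in> paths (basic_cycle n)" "path_source p = v" "path_length p = 1"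
    then show "p = cpath v 1" using path_eq_cpath(1) by metis
  qed (use v in \<open>auto simp: basic_cycle_sel\<close>)
  also have "\<dots> \<longleftrightarrow> (\<exists>l. nonzero (cpath (shift v 1) l) \<and> \<not> nonzero (cpath v (1 + l)))"
  proof
    assume "\<exists>q. nonzero q \<and> path_source q = target (cpath v 1) \<and> \<not> nonzero (path_concat q (cpath v 1))"
    then obtain q where q: "nonzero q" "path_source q = shift v 1" "\<not> nonzero (path_concat q (cpath v 1))"
      using v by auto
    have "q = cpath (shift v 1) (path_length q)"
      using path_eq_cpath(1)[OF nonzero_path_in_paths[OF q(1)]] q(2) by simp
    then show "\<exists>l. nonzero (cpath (shift v 1) l) \<and> \<not> nonzero (cpath v (1 + l))"
      using q by (metis path_concat_cpath)
  next
    assume "\<exists>l. nonzero (cpath (shift v 1) l) \<and> \<not> nonzero (cpath v (1 + l))"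
    then show "\<exists>q. nonzero q \<and> path_source q = target (cpath v 1) \<and> \<not> nonzero (path_concat q (cpath v 1))"
      using v by (metis path_concat_cpath path_source_cpath target_cpath)
  qed
  also have "\<dots> \<longleftrightarrow> (\<exists>l. l < cdim (shift v 1) \<and> cdim v \<le> 1 + l)"
    using v by (simp add: nonzero_cpath_iff not_less)
  also have "\<dots> \<longleftrightarrow> cdim v \<le> cdim (shift v 1)"
    using cdim_ge_2[of "shift v 1"] by (auto intro!: exI[of _ "cdim (shift v 1) - 1"])
  finally show ?thesis .
qed

lemma theta_eq: "\<theta> v = shift v (cdim v)"
  by (simp add: theta_def cycle_shift_def)

section \<open>Perfect pairs on the cycle\<close>

text \<open>
  The shortest path whose concatenation with \<open>q\<close> is zero, for a nonzero path \<open>q\<close>.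
\<close>

definition next_path :: "(nat, nat) path \<Rightarrow> (nat, nat) path"
  where "next_path q = cpath (target q) (cdim (path_source q) - path_length q)"

lemma zero_iff_not_nonzero: "p \<in> paths (basic_cycle n) \<Longrightarrow> path_elem p \<in> I \<longleftrightarrow> \<not> nonzero p"
  by (simp add: nonzero_path_def)

text \<open>
  Minimality of \<open>p\<close>, applied to the shortest path that annihilates \<open>q\<close> from the left, shows that
  \<open>p\<close> is that path. Minimality of \<open>q\<close>, applied to \<open>q\<close> without its first arrow, shows that the product
  of \<open>p\<close> with this shorter path is nonzero. That product starts one vertex later and has length one
  less than the dimension at the source of \<open>q\<close>, so this source is black.
\<close>

lemma perfect_pairD:
  assumes "perfect_pair (basic_cycle n) I p q"
  shows "nonzero q" "path_length q \<ge> 1" "black (path_source q)" "p = next_path q"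
proof -
  let ?i = "path_source q" and ?l = "path_length q" and ?m = "path_length p"
  let ?j = "shift ?i ?l"
  show q: "nonzero q" and l: "?l \<ge> 1" using assms by (simp_all add: perfect_pair_def)
  have i: "?i \<in> {1..n}" and q_eq: "q = cpath ?i ?l"
    using path_eq_cpath[OF nonzero_path_in_paths[OF q]] by auto
  have tq: "target q = ?j" using q_eq i target_cpath by metis
  have p: "nonzero p" "path_source p = ?j" using assms tq by (simp_all add: perfect_pair_def)
  have p_eq: "p = cpath ?j ?m" using path_eq_cpath(1)[OF nonzero_path_in_paths[OF p(1)]] p(2) by simp
  have pq: "path_concat p q = cpath ?i (?l + ?m)" using path_concat_cpath p_eq q_eq by metis
  have lc: "?l < cdim ?i" and mc: "?m < cdim ?j" using p q by (auto simp: nonzero_iff)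
  have "path_elem (path_concat p q) \<in> I" using assms by (simp add: perfect_pair_def)
  then have ge: "cdim ?i \<le> ?l + ?m" unfolding pq using i by (simp add: zero_iff_not_nonzero nonzero_cpath_iff)
  have m_eq: "?m = cdim ?i - ?l"
  proof -
    \<comment> \<open>The annihilating path of minimal length is a left multiple of \<open>p\<close>, hence as long as \<open>p\<close>.\<close>
    let ?p' = "cpath ?j (cdim ?i - ?l)"
    have "nonzero ?p'" using ge mc by (simp add: nonzero_cpath_iff)
    moreover have "path_concat ?p' q = cpath ?i (cdim ?i)" using path_concat_cpath q_eq lc
      by (metis le_add_diff_inverse less_imp_le)
    then have "path_elem (path_concat ?p' q) \<in> I" using i by (simp add: zero_iff_not_nonzero nonzero_cpath_iff)
    ultimately obtain p'' where "?p' = path_concat p'' p"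
      using assms tq unfolding perfect_pair_def by (metis path_source_cpath)
    then have "path_length ?p' = ?m + path_length p''" by simp
    then show ?thesis using ge by simp
  qed
  then show "p = next_path q" using p_eq tq by (simp add: next_path_def)
  have "nonzero (path_concat p (cpath (shift ?i 1) (?l - 1)))"
  proof (rule ccontr)
    \<comment> \<open>If this product were zero, \<open>q\<close> would be a factor of a path shorter than itself. The truncated
      path may be trivial.\<close>
    let ?q' = "cpath (shift ?i 1) (?l - 1)"
    assume zero: "\<not> nonzero (path_concat p ?q')"
    have "cdim ?i \<le> cdim (shift ?i 1) + 1" by (rule cdim_shift_le[OF i])
    then have "nonzero ?q'" using l lc by (simp add: nonzero_cpath_iff)
    moreover have t: "target ?q' = path_source p" using p(2) l by simp
    moreover have "path_elem (path_concat p ?q') \<in> I"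
      using zero path_concat_in_paths[of p ?q'] t p(1)
      by (subst zero_iff_not_nonzero) (simp_all add: nonzero_path_in_paths)
    ultimately obtain q'' where "?q' = path_concat q q''"
      using assms unfolding perfect_pair_def by metis
    then have "path_length ?q' = path_length q'' + ?l" by simp
    then show False using l by simp
  qed
  moreover have "path_concat p (cpath (shift ?i 1) (?l - 1)) = cpath (shift ?i 1) (?l - 1 + ?m)"
  proof -
    have "p = cpath (shift (shift ?i 1) (?l - 1)) ?m" using p_eq l by simp
    then show ?thesis using path_concat_cpath by metis
  qed
  ultimately have "?l - 1 + ?m < cdim (shift ?i 1)" by (simp add: nonzero_cpath_iff)
  then show "black ?i" using i l lc m_eq by (simp add: black_iff)
qed

text \<open>
  Blackness of the source \<open>i\<close> of \<open>q\<close> says that a zero path starting at the next vertex cannot end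
  before \<open>i + cdim i + 1\<close>, counting along the unrolled cycle; the same then holds for all later
  starting vertices. Thus \<open>next_path q\<close> itself is nonzero, and a path that it annihilates
  must start at \<open>i\<close> or earlier, so it has \<open>q\<close> as a left factor. Minimality of \<open>next_path q\<close> only
  compares lengths.
\<close>

lemma perfect_pair_next_path:
  assumes q: "nonzero q" "path_length q \<ge> 1" "black (path_source q)"
  shows "perfect_pair (basic_cycle n) I (next_path q) q"
proof -
  define i l where "i = path_source q" and "l = path_length q"
  define m where "m = cdim i - l"
  let ?j = "shift i l"
  have i: "i \<in> {1..n}" and q_eq: "q = cpath i l"
    using path_eq_cpath[OF nonzero_path_in_paths[OF q(1)]] by (auto simp: i_def l_def)
  have l: "l \<ge> 1" "l < cdim i" using q by (auto simp: nonzero_iff i_def l_def)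
  have p_eq: "next_path q = cpath ?j m" unfolding next_path_def using i by (simp add: q_eq m_def)
  have black: "cdim i \<le> cdim (shift i 1)" using q(3) i by (simp add: black_iff i_def)
  have later: "cdim i \<le> cdim (shift i k) + (k - 1)" if "k \<ge> 1" for k
    using black cdim_shift_le[of "shift i 1" "k - 1"] that by simp
  have lm: "l + m = cdim i" using l by (simp add: m_def)
  have nz: "nonzero (cpath ?j m)" using later[OF l(1)] l lm by (simp add: nonzero_cpath_iff)
  have P2: "\<exists>q''\<in>paths (basic_cycle n). path_source q = target q'' \<and> q' = path_concat q q''"
    if q': "nonzero q'" "target q' = ?j" "path_elem (path_concat (cpath ?j m) q') \<in> I" for q'
  proof -
    define i' l' where "i' = path_source q'" and "l' = path_length q'"
    have i': "i' \<in> {1..n}" and q'_eq: "q' = cpath i' l'"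
      using path_eq_cpath[OF nonzero_path_in_paths[OF q'(1)]] by (auto simp: i'_def l'_def)
    have j: "shift i' l' = ?j" using q'(2) i' by (simp add: q'_eq)
    have "path_concat (cpath ?j m) q' = cpath i' (l' + m)"
      using path_concat_cpath[of i' l' m] by (simp add: j q'_eq)
    then have zero: "cdim i' \<le> l' + m" using q'(3) i' by (simp add: zero_iff_not_nonzero nonzero_cpath_iff)
    show ?thesis
    proof (cases "l \<le> l'")
      case True
      have "shift (shift i' (l' - l)) l = shift i l" using True j by simp
      then have i_eq: "shift i' (l' - l) = i" using cycle_shift_inj[OF n_pos _ i] by simp
      have "q' = path_concat q (cpath i' (l' - l))"
        using path_concat_cpath[of i' "l' - l" l] True by (simp add: i_eq q_eq q'_eq)
      then show ?thesis using i' i_eq by (intro bexI[of _ "cpath i' (l' - l)"]) (simp_all add: q_eq)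
    next
      case False
      have "shift (shift i (l - l')) l' = shift i' l'" using False j by simp
      then have "shift i (l - l') = i'" using cycle_shift_inj[OF n_pos _ i'] by simp
      then have "cdim i \<le> cdim i' + (l - l' - 1)" using later[of "l - l'"] False by simp
      then show ?thesis using zero lm False by simp
    qed
  qed
  have P3: "\<exists>p''\<in>paths (basic_cycle n). path_source p'' = target (cpath ?j m) \<and>
      p' = path_concat p'' (cpath ?j m)"
    if p': "nonzero p'" "path_source p' = ?j" "path_elem (path_concat p' q) \<in> I" for p'
  proof -
    define m' where "m' = path_length p'"
    have p'_eq: "p' = cpath ?j m'"
      using path_eq_cpath(1)[OF nonzero_path_in_paths[OF p'(1)]] p'(2) by (simp add: m'_def)
    have "path_concat p' q = cpath i (l + m')" by (simp add: p'_eq q_eq)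
    then have "m \<le> m'" using p'(3) i lm by (simp add: zero_iff_not_nonzero nonzero_cpath_iff)
    then have "p' = path_concat (cpath (shift ?j m) (m' - m)) (cpath ?j m)"
      unfolding path_concat_cpath by (simp add: p'_eq)
    then show ?thesis by (intro bexI[of _ "cpath (shift ?j m) (m' - m)"]) simp_all
  qed
  have "path_elem (path_concat (cpath ?j m) q) \<in> I"
    using i lm by (simp add: q_eq zero_iff_not_nonzero nonzero_cpath_iff)
  then show ?thesis
    unfolding perfect_pair_def p_eq
    using q(1) nz l lm P2 P3 i by (auto simp: q_eq m_def)
qed

text \<open>
  Both paths are annihilated by \<open>p\<close>, so by minimality each of them is a left factor of the other,
  and they have the same length.
\<close>

lemma perfect_pair_unique_right:
  assumes "perfect_pair Q' J p q" "perfect_pair Q' J p q'"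
  shows "q = q'"
proof -
  obtain r where r: "q' = path_concat q r" "path_source q = path_target Q' r"
    using assms unfolding perfect_pair_def by metis
  obtain r' where r': "q = path_concat q' r'"
    using assms unfolding perfect_pair_def by metis
  have "path_length q' = path_length r + path_length q" using r(1) by simp
  moreover have "path_length q = path_length r' + path_length q'"
    using r' path_length_concat by metis
  ultimately have "r = trivial_path (path_source r)" by (simp flip: path_length_0_iff)
  then show ?thesis using r by (metis path_concat_trivial_right path_target_trivial)
qed

lemma next_path_source: "path_source (next_path q) = target q"
  by (simp add: next_path_def)

lemma next_path_target:
  assumes "nonzero q"
  shows "target (next_path q) = \<theta> (path_source q)"
proof -
  obtain i l where q: "q = cpath i l" "i \<in> {1..n}"
    using path_eq_cpath[OF nonzero_path_in_paths[OF assms]] by blast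
  then have "l < cdim i" using assms by (simp add: nonzero_cpath_iff)
  then show ?thesis using q by (simp add: next_path_def theta_eq)
qed

lemma theta_in_range: "v \<in> {1..n} \<Longrightarrow> (\<theta> ^^ d) v \<in> {1..n}"
  by (induction d) (simp_all add: theta_eq)

text \<open>
  Passing to \<open>next_path\<close> replaces the source and target \<open>(s, t)\<close> by \<open>(t, \<theta> s)\<close>.
\<close>

lemma next_path_twice_pow:
  assumes "\<And>k. nonzero ((next_path ^^ k) p)"
  shows "path_source ((next_path ^^ (2 * d)) p) = (\<theta> ^^ d) (path_source p) \<and>
    target ((next_path ^^ (2 * d)) p) = (\<theta> ^^ d) (target p)"
proof (induction d)
  case (Suc d)
  let ?q = "(next_path ^^ (2 * d)) p"
  have "nonzero ?q" "nonzero (next_path ?q)" using assms[of "2 * d"] assms[of "Suc (2 * d)"] by auto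
  then show ?case using Suc by (simp add: next_path_source next_path_target)
qed simp

section \<open>Perfect paths\<close>

text \<open>
  In a sequence witnessing perfection each member is the \<open>next_path\<close> of its successor, so iterating
  \<open>next_path\<close> runs through the sequence backwards and returns to the start after \<open>m\<close> steps.
\<close>

lemma perfect_pathD:
  assumes "perfect_path (basic_cycle n) I p"
  obtains m where "m \<ge> 1" "(next_path ^^ m) p = p"
    "\<forall>k. nonzero ((next_path ^^ k) p) \<and> black (path_source ((next_path ^^ k) p))"
proof -
  obtain m :: nat and ps :: "nat \<Rightarrow> (nat, nat) path" where m: "m \<ge> 1" and ps: "ps 1 = p" "ps (m + 1) = p" and
    pair: "\<And>i. i \<in> {1..m} \<Longrightarrow> perfect_pair (basic_cycle n) I (ps i) (ps (i + 1))"
    using assms unfolding perfect_path_def by metis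
  have pow: "ps (m + 1 - k) = (next_path ^^ k) p" if "k \<le> m" for k
    using that
  proof (induction k)
    case (Suc k)
    then have "ps (m - k) = next_path (ps (m - k + 1))" using perfect_pairD(4)[OF pair[of "m - k"]] by simp
    then show ?case using Suc by (simp add: Suc_diff_le)
  qed (use ps in simp)
  have period: "(next_path ^^ m) p = p" using pow[of m] ps by simp
  have "nonzero ((next_path ^^ k) p) \<and> black (path_source ((next_path ^^ k) p))" for k
  proof -
    have k: "k mod m < m" using m by simp
    have "ps (m - k mod m + 1) = (next_path ^^ (k mod m)) p" using pow[of "k mod m"] k by (simp add: Suc_diff_le)
    moreover have "m - k mod m \<in> {1..m}" using k by auto
    ultimately have "nonzero ((next_path ^^ (k mod m)) p) \<and> black (path_source ((next_path ^^ (k mod m)) p))"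
      using perfect_pairD(1,3)[OF pair] by metis
    then show ?thesis by (simp add: funpow_mod_eq[OF period])
  qed
  then show ?thesis using that[OF m period] by blast
qed

lemma perfect_path_imp_cyclically_black:
  assumes "perfect_path (basic_cycle n) I p"
  shows "theta_cyclically_black n I (path_source p)" "theta_cyclically_black n I (target p)"
proof -
  obtain m where m: "m \<ge> 1" and period: "(next_path ^^ m) p = p" and
    "\<forall>k. nonzero ((next_path ^^ k) p) \<and> black (path_source ((next_path ^^ k) p))"
    using assms by (rule perfect_pathD)
  then have all: "nonzero ((next_path ^^ k) p)" "black (path_source ((next_path ^^ k) p))" for k
    by blast+
  note pow = next_path_twice_pow[of p, OF all(1)]
  have p: "p \<in> paths (basic_cycle n)" using all(1)[of 0] by (simp add: nonzero_path_in_paths)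
  have cyclic: "theta_cyclic n I v" if "v \<in> {1..n}" "(\<theta> ^^ m) v = v" for v
    unfolding theta_cyclic_def
  proof (rule INT_I)
    fix d :: nat
    have "d \<le> m * d" using m by simp
    then have "(\<theta> ^^ d) ((\<theta> ^^ (m * d - d)) v) = (\<theta> ^^ (m * d)) v"
      by (simp add: funpow_add[symmetric, unfolded o_def fun_eq_iff])
    also have "\<dots> = v" using funpow_mod_eq[OF that(2), of "m * d"] by simp
    finally show "v \<in> (\<theta> ^^ d) ` {1..n}"
      using theta_in_range[OF that(1), of "m * d - d"] by (metis image_eqI)
  qed
  have "(next_path ^^ (2 * m)) p = p" using funpow_mod_eq[OF period, of "2 * m"] by simp
  then have "(\<theta> ^^ m) (path_source p) = path_source p" "(\<theta> ^^ m) (target p) = target p"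
    using pow[of m] by auto
  then have "theta_cyclic n I (path_source p)" "theta_cyclic n I (target p)"
    using path_source_in_verts[OF p] path_target_in_verts[OF p] by (auto intro!: cyclic simp: basic_cycle_sel)
  moreover have "black ((\<theta> ^^ d) (path_source p))" for d
    using all(2)[of "2 * d"] pow[of d] by simp
  moreover have "black ((\<theta> ^^ d) (target p))" for d
    using all(2)[of "Suc (2 * d)"] pow[of d] by (simp add: next_path_source)
  ultimately show "theta_cyclically_black n I (path_source p)" "theta_cyclically_black n I (target p)"
    by (simp_all add: theta_cyclically_black_def)
qed

text \<open>
  The iterates of \<open>next_path\<close> stay in the finite set \<open>F\<close>, so two of them coincide, and injectivity
  on \<open>F\<close> allows the common initial part to be cancelled.
\<close>

lemma perfect_path_if_always_black:
  assumes p: "nonzero p" "path_length p \<ge> 1"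
    and black: "\<And>d. black ((\<theta> ^^ d) (path_source p))" "\<And>d. black ((\<theta> ^^ d) (target p))"
  shows "perfect_path (basic_cycle n) I p"
proof -
  define F where "F = {q. nonzero q \<and> path_length q \<ge> 1 \<and>
    (\<forall>d. black ((\<theta> ^^ d) (path_source q)) \<and> black ((\<theta> ^^ d) (target q)))}"
  have pair: "perfect_pair (basic_cycle n) I (next_path q) q" if "q \<in> F" for q
  proof (rule perfect_pair_next_path)
    show "nonzero q" "path_length q \<ge> 1" using that by (simp_all add: F_def)
    have "black ((\<theta> ^^ 0) (path_source q))" using that unfolding F_def by blast
    then show "black (path_source q)" by simp
  qed
  have closed: "next_path q \<in> F" if q: "q \<in> F" for q
  proof -
    have "nonzero (next_path q)" "path_length (next_path q) \<ge> 1"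
      using pair[OF q] by (simp_all add: perfect_pair_def)
    moreover have "black ((\<theta> ^^ d) (\<theta> (path_source q)))" for d
    proof -
      have "black ((\<theta> ^^ Suc d) (path_source q))" using q unfolding F_def by blast
      then show ?thesis by (simp add: funpow_swap1)
    qed
    ultimately show ?thesis using q by (simp add: F_def next_path_source next_path_target)
  qed
  have inj: "q = q'" if "q \<in> F" "q' \<in> F" "next_path q = next_path q'" for q q'
    using pair[OF that(1)] pair[OF that(2)] that(3) perfect_pair_unique_right by metis
  have orbit: "(next_path ^^ k) p \<in> F" for k
    using p black closed by (induction k) (auto simp: F_def)
  have "finite F" by (rule finite_subset[OF _ finite_nonzero_paths]) (auto simp: F_def)
  then have "\<not> inj (\<lambda>k. (next_path ^^ k) p)"
    using orbit by (metis finite_imageD finite_subset image_subsetI infinite_UNIV_nat)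
  then obtain a b where "a < b" "(next_path ^^ a) p = (next_path ^^ b) p"
    unfolding inj_def by (metis linorder_neqE_nat)
  then obtain m where m: "m \<ge> 1" "(next_path ^^ a) p = (next_path ^^ (a + m)) p"
    by (metis add_diff_inverse_nat less_imp_not_less not_less_eq_eq One_nat_def less_numeral_extra(3) zero_less_diff Suc_leI)
  have period: "p = (next_path ^^ m) p"
    using m(2)
  proof (induction a)
    case (Suc a)
    then show ?case using inj[OF orbit orbit, of a "a + m"] by simp
  qed simp
  \<comment> \<open>The pairs are \<open>(next_path q, q)\<close>, so the sequence lists the iterates in reverse order.\<close>
  define ps where "ps i = (next_path ^^ (m + 1 - i)) p" for i
  have "perfect_pair (basic_cycle n) I (ps i) (ps (i + 1))" if "i \<in> {1..m}" for i
  proof -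
    have "ps i = next_path (ps (i + 1))" using that by (auto simp: ps_def Suc_diff_le)
    then show ?thesis using pair[of "ps (i + 1)"] orbit by (simp add: ps_def)
  qed
  moreover have "nonzero (ps i)" for i
    using orbit[of "m + 1 - i"] by (simp add: ps_def F_def)
  ultimately show ?thesis
    unfolding perfect_path_def using p m(1) period
    by (intro conjI exI[of _ m] exI[of _ ps]) (simp_all add: ps_def)
qed

end

theorem proposition6p2:
  fixes n :: nat
    and I :: "((nat, nat) path \<Rightarrow>\<^sub>0 'k::field) set"
    and p :: "(nat, nat) path"
  assumes "n \<ge> 1"
    and "monomial_ideal (basic_cycle n) I"
    and "nonzero_path (basic_cycle n) I p"
    and "path_length p \<ge> 1"
  shows "perfect_path (basic_cycle n) I p \<longleftrightarrow>
    theta_cyclically_black n I (path_source p) \<and>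
    theta_cyclically_black n I (path_target (basic_cycle n) p)"
proof -
  interpret cyclic_monomial_algebra n I by unfold_locales (rule assms)+
  show ?thesis
  proof
    assume "perfect_path (basic_cycle n) I p"
    then show "theta_cyclically_black n I (path_source p) \<and> theta_cyclically_black n I (target p)"
      using perfect_path_imp_cyclically_black by blast
  next
    assume "theta_cyclically_black n I (path_source p) \<and> theta_cyclically_black n I (target p)"
    then show "perfect_path (basic_cycle n) I p"
      using perfect_path_if_always_black[OF assms(3,4)] unfolding theta_cyclically_black_def by blast
  qed
qed

end
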